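(* Let $C: f=0$ be a reduced nodal curve in $\mathbb{P}^2$ (over $\mathbb{C}$) of degree $d \geq 4$, having exactly $n>0$ nodes. If $C$ is irreducible and $n < (d-1)/2$, or if $C$ is reducible and $n < (d-2)/2$, then $C$ is Torelli.
   Context: A nodal curve is a reduced plane curve all of whose singularities are nodes ($A_1$). For a reduced curve $C: f=0$ of degree $d$ in $\mathbb{P}^2$, with $f\in S=\mathbb{C}[x,y,z]$ homogeneous, the sheaf of logarithmic vector fields $T\langle C\rangle$ is the rank two vector bundle on $\mathbb{P}^2$ which is the kernel of the map $\mathcal{O}_{\mathbb{P}^2}(1)^3 \to \mathcal{J}_f(d)$, $(a,b,c)\mapsto af_x+bf_y+cf_z$, where $\mathcal{J}_f\subset \mathcal{O}_{\mathbb{P}^2}$ is the ideal sheaf generated by the partial derivatives $f_x,f_y,f_z$. The curve $C$ is called Torelli (in the sense of Dolgachev–Kapranov) if it can be reconstructed from $T\langle C\rangle$, i.e. if for every reduced curve $C'\subset\mathbb{P}^2$ with $T\langle C'\rangle\cong T\langle C\rangle$ one has $C'=C$. *)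

theory Defs
  imports "HOL-Analysis.Analysis" "HOL-Computational_Algebra.Computational_Algebra"
begin

section \<open>Ternary forms\<close>

text \<open>
  The ring \<open>\<complex>[x,y,z]\<close> is \<open>\<complex>[x][y][z]\<close>: the outermost variable is \<open>z\<close>, the innermost one is \<open>x\<close>.
  A vector of type \<open>complex^3\<close> has the coordinates \<open>(x, y, z)\<close>.
\<close>

type_synonym tpoly = "complex poly poly poly"

definition homogeneous :: "nat \<Rightarrow> tpoly \<Rightarrow> bool" where
  "homogeneous d f \<longleftrightarrow>
     (\<forall>i j k. coeff (coeff (coeff f k) j) i \<noteq> 0 \<longrightarrow> i + j + k = d)"

definition ev :: "tpoly \<Rightarrow> complex^3 \<Rightarrow> complex" where
  "ev f v = poly (poly (poly f [:[:v $ 3:]:]) [:v $ 2:]) (v $ 1)"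

definition partial_x :: "tpoly \<Rightarrow> tpoly" where "partial_x f = map_poly (map_poly pderiv) f"
definition partial_y :: "tpoly \<Rightarrow> tpoly" where "partial_y f = map_poly pderiv f"
definition partial_z :: "tpoly \<Rightarrow> tpoly" where "partial_z f = pderiv f"

section \<open>Plane curves and nodes\<close>

text \<open>
  A plane curve is given by a form of positive degree, which it determines up to a nonzero scalar.
  It is reduced iff the form is squarefree, and (for a reduced curve) irreducible iff the form is.
\<close>

definition reduced_curve :: "nat \<Rightarrow> tpoly \<Rightarrow> bool" where
  "reduced_curve d f \<longleftrightarrow> d \<ge> 1 \<and> homogeneous d f \<and> squarefree f"

definition same_curve :: "tpoly \<Rightarrow> tpoly \<Rightarrow> bool" where
  "same_curve f g \<longleftrightarrow> (\<exists>c. c \<noteq> 0 \<and> g = smult [:[:c:]:] f)"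

text \<open>The point \<open>[v]\<close> of the projective plane, as the set of all its homogeneous coordinate vectors.\<close>

definition proj_point :: "complex^3 \<Rightarrow> (complex^3) set" where
  "proj_point v = {c *s v | c. c \<noteq> 0}"

definition singular_at :: "tpoly \<Rightarrow> complex^3 \<Rightarrow> bool" where
  "singular_at f p \<longleftrightarrow> p \<noteq> 0 \<and> ev f p = 0 \<and>
     ev (partial_x f) p = 0 \<and> ev (partial_y f) p = 0 \<and> ev (partial_z f) p = 0"

text \<open>
  A basis \<open>p, u, v\<close> of \<open>\<complex>\<^sup>3\<close> gives the affine chart \<open>(s,t) \<mapsto> [p + s u + t v]\<close> centred at \<open>[p]\<close>;
  \<open>g \<in> \<complex>[s][t]\<close> is the equation of the curve in this chart, so that
  \<open>coeff (coeff g j) i\<close> is the coefficient of \<open>s\<^sup>i t\<^sup>j\<close>.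
\<close>

definition local_equation ::
    "tpoly \<Rightarrow> complex^3 \<Rightarrow> complex^3 \<Rightarrow> complex^3 \<Rightarrow> complex poly poly \<Rightarrow> bool" where
  "local_equation f p u v g \<longleftrightarrow>
     det (vector [p, u, v] :: complex^3^3) \<noteq> 0 \<and>
     (\<forall>s t. poly (poly g [:t:]) s = ev f (p + s *s u + t *s v))"

text \<open>
  A node is a double point with two distinct tangents: the local equation has neither constant nor
  linear terms, and its quadratic part is the product \<open>(a s + b t) (a' s + b' t)\<close> of two linearly
  independent linear forms.  The choice of the chart does not matter.
\<close>

definition node_at :: "tpoly \<Rightarrow> complex^3 \<Rightarrow> bool" where
  "node_at f p \<longleftrightarrow>
     (\<exists>u v g. local_equation f p u v g \<and>
        coeff (coeff g 0) 0 = 0 \<and> coeff (coeff g 0) 1 = 0 \<and> coeff (coeff g 1) 0 = 0 \<and>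
        (\<exists>a b a' b'. a * b' - a' * b \<noteq> 0 \<and>
           coeff (coeff g 0) 2 = a * a' \<and>
           coeff (coeff g 1) 1 = a * b' + a' * b \<and>
           coeff (coeff g 2) 0 = b * b'))"

definition nodal :: "tpoly \<Rightarrow> bool" where
  "nodal f \<longleftrightarrow> (\<forall>p. singular_at f p \<longrightarrow> node_at f p)"

definition nodes :: "tpoly \<Rightarrow> (complex^3) set set" where
  "nodes f = {proj_point p | p. node_at f p}"

section \<open>Sheaves on the projective plane\<close>

text \<open>
  A Zariski open subset of the projective plane is represented by its preimage in
  \<open>\<complex>\<^sup>3 - {0}\<close>, the union of the complements of the zero sets of the forms in \<open>A\<close>.
\<close>

definition zariski_open :: "(complex^3) set \<Rightarrow> bool" where
  "zariski_open W \<longleftrightarrow>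
     (\<exists>A. (\<forall>F\<in>A. \<exists>m. homogeneous m F) \<and> W = {v. v \<noteq> 0 \<and> (\<exists>F\<in>A. ev F v \<noteq> 0)})"

text \<open>
  Sections of \<open>\<O>(k)\<close> over \<open>W\<close>: functions on the cone \<open>W\<close> that are locally quotients \<open>G/H\<close> of
  forms with \<open>deg G - deg H = k\<close>.  To make sections unique as total functions,
  they are set to \<open>0\<close> outside \<open>W\<close>.  The structure sheaf is \<open>twist 0\<close>.
\<close>

definition twist :: "int \<Rightarrow> (complex^3) set \<Rightarrow> (complex^3 \<Rightarrow> complex) set" where
  "twist k W =
     {s. (\<forall>v. v \<notin> W \<longrightarrow> s v = 0) \<and>
         (\<forall>w\<in>W. \<exists>V G H m n. zariski_open V \<and> w \<in> V \<and> V \<subseteq> W \<and>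
            homogeneous m G \<and> homogeneous n H \<and> int m - int n = k \<and>
            (\<forall>v\<in>V. ev H v \<noteq> 0 \<and> s v = ev G v / ev H v))}"

definition restrict_sec :: "(complex^3) set \<Rightarrow> (complex^3 \<Rightarrow> complex^3) \<Rightarrow> complex^3 \<Rightarrow> complex^3" where
  "restrict_sec V s = (\<lambda>v. if v \<in> V then s v else 0)"

text \<open>
  \<open>T\<langle>C\<rangle>\<close> as a subsheaf of \<open>\<O>(1)\<^sup>3\<close>: the kernel of \<open>(a,b,c) \<mapsto> a f\<^sub>x + b f\<^sub>y + c f\<^sub>z\<close>.
  Since the target \<open>\<J>\<^sub>f(d)\<close> is a subsheaf of \<open>\<O>(d)\<close>, the image is zero iff it is zero as a function.
\<close>

definition log_sheaf :: "tpoly \<Rightarrow> (complex^3) set \<Rightarrow> (complex^3 \<Rightarrow> complex^3) set" where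
  "log_sheaf f W =
     {s. (\<forall>i. (\<lambda>v. s v $ i) \<in> twist 1 W) \<and>
         (\<forall>v\<in>W. s v $ 1 * ev (partial_x f) v + s v $ 2 * ev (partial_y f) v
                 + s v $ 3 * ev (partial_z f) v = 0)}"

text \<open>Isomorphism of sheaves of modules over the structure sheaf, for subsheaves of \<open>\<O>(1)\<^sup>3\<close>.\<close>

definition sheaf_iso ::
    "((complex^3) set \<Rightarrow> (complex^3 \<Rightarrow> complex^3) set) \<Rightarrow>
     ((complex^3) set \<Rightarrow> (complex^3 \<Rightarrow> complex^3) set) \<Rightarrow> bool" where
  "sheaf_iso E F \<longleftrightarrow>
     (\<exists>\<phi>. \<forall>W. zariski_open W \<longrightarrow>
        bij_betw (\<phi> W) (E W) (F W) \<and>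
        (\<forall>s\<in>E W. \<forall>t\<in>E W. \<phi> W (\<lambda>v. s v + t v) = (\<lambda>v. \<phi> W s v + \<phi> W t v)) \<and>
        (\<forall>r\<in>twist 0 W. \<forall>s\<in>E W. \<phi> W (\<lambda>v. r v *s s v) = (\<lambda>v. r v *s \<phi> W s v)) \<and>
        (\<forall>V. zariski_open V \<and> V \<subseteq> W \<longrightarrow>
           (\<forall>s\<in>E W. \<phi> V (restrict_sec V s) = restrict_sec V (\<phi> W s))))"

definition torelli :: "tpoly \<Rightarrow> bool" where
  "torelli f \<longleftrightarrow>
     (\<forall>e g. reduced_curve e g \<and> sheaf_iso (log_sheaf g) (log_sheaf f) \<longrightarrow> same_curve f g)"

end

theory Submission imports Defs "HOL-Computational_Algebra.Field_as_Ring" begin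

text \<open>
  Write \<open>F = \<nabla>f\<close>. The syzygies of \<open>F\<close> are the sections of the twists of \<open>T\<langle>C\<rangle>\<close>, so an isomorphism
  \<open>T\<langle>C'\<rangle> \<cong> T\<langle>C\<rangle>\<close> gives an isomorphism of graded syzygy modules.

  A syzygy \<open>\<rho>\<close> of degree at most \<open>d - 1\<close> is a Koszul syzygy \<open>a \<times> F\<close> when \<open>n \<le> d - 3\<close>. Indeed, the gradient
  ideal multiplies \<open>\<rho>\<close> into the Koszul syzygies and is locally the maximal ideal at each node,
  so every product of \<open>n\<close> linear forms, one through each node, does so as well. If a syzygy \<open>u\<close>
  of degree at most \<open>2 d - 5\<close> becomes Koszul after multiplication with the linear forms through a point,
  then \<open>u\<close> is Koszul: from \<open>l u = \<alpha> \<times> F\<close> and \<open>l' u = \<beta> \<times> F\<close> it follows that \<open>l' \<alpha> - l \<beta>\<close> is a multiple of \<open>F\<close>,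
  hence zero for degree reasons, hence \<open>l\<close> divides \<open>\<alpha>\<close>. The linear factors are removed one at a time.

  Hence the isomorphism maps \<open>a \<times> \<nabla>g\<close> to \<open>A a \<times> \<nabla>f\<close> for a constant invertible matrix \<open>A\<close>, and the
  relation \<open>\<nabla>g \<times> \<nabla>g = 0\<close> turns into \<open>A \<nabla>g \<parallel> \<nabla>f\<close>. Comparing Hessians at a node shows \<open>g = c f\<close>.
\<close>

no_notation fps_nth (infixl "$" 75)

section \<open>The ring of ternary polynomials\<close>

definition is_hom :: "('a::comm_ring_1 \<Rightarrow> 'b::comm_ring_1) \<Rightarrow> bool" where
  "is_hom h \<longleftrightarrow> h 1 = 1 \<and> (\<forall>a b. h (a + b) = h a + h b) \<and> (\<forall>a b. h (a * b) = h a * h b)"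

lemma is_homI:
  assumes "h 1 = 1" "\<And>a b. h (a + b) = h a + h b" "\<And>a b. h (a * b) = h a * h b"
  shows "is_hom h"
  using assms by (auto simp: is_hom_def)

lemma is_hom_one: "is_hom h \<Longrightarrow> h 1 = 1"
  and is_hom_add: "is_hom h \<Longrightarrow> h (a + b) = h a + h b"
  and is_hom_mult: "is_hom h \<Longrightarrow> h (a * b) = h a * h b"
  by (auto simp: is_hom_def)

lemma is_hom_zero: "is_hom h \<Longrightarrow> h 0 = 0"
  using is_hom_add[of h 0 0] by simp

lemma is_hom_eval:
  assumes "is_hom h"
  shows "is_hom (\<lambda>p. poly (map_poly h p) x)"
proof -
  note [simp] = is_hom_zero[OF assms] is_hom_one[OF assms] is_hom_add[OF assms] is_hom_mult[OF assms]
  let ?e = "\<lambda>p. poly (map_poly h p) x"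
  have add: "?e (p + q) = ?e p + ?e q" for p q
    by (induction p q rule: poly_induct2) (simp_all add: map_poly_pCons algebra_simps)
  have smult: "?e (smult a q) = h a * ?e q" for a q
    by (induction q) (simp_all add: map_poly_pCons algebra_simps)
  have mult: "?e (p * q) = ?e p * ?e q" for p q
    by (induction p) (simp_all add: map_poly_pCons add smult algebra_simps)
  show ?thesis
    by (rule is_homI) (simp_all add: add mult map_poly_pCons one_pCons)
qed

definition const :: "complex \<Rightarrow> tpoly" where "const c = [:[:[:c:]:]:]"

definition vars :: "tpoly^3" where
  "vars = vector [[:[:[:0, 1:]:]:], [:[:0, 1:]:], [:0, 1:]]"

lemma vars_nth [simp]:
  "vars $ 1 = [:[:[:0, 1:]:]:]" "vars $ 2 = [:[:0, 1:]:]" "vars $ 3 = [:0, 1:]"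
  by (simp_all add: vars_def vector_3)

lemma const_0 [simp]: "const 0 = 0" and const_1 [simp]: "const 1 = 1"
  and const_add: "const (a + b) = const a + const b"
  and const_mult: "const (a * b) = const a * const b"
  and const_diff: "const (a - b) = const a - const b"
  and const_eq_iff [simp]: "const a = const b \<longleftrightarrow> a = b"
  by (simp_all add: const_def one_pCons)

lemma const_eq_0_iff [simp]: "const a = 0 \<longleftrightarrow> a = 0"
  by (simp add: const_def)

lemma const_inverse: "c \<noteq> 0 \<Longrightarrow> const c * const (inverse c) = 1"
  by (simp flip: const_mult)

lemma const_of_nat: "const (of_nat n) = of_nat n"
  by (induction n) (simp_all add: const_add)

lemma tpoly_induct [case_names const var add mult]:
  fixes f :: tpoly
  assumes c: "\<And>c. P (const c)" and v: "\<And>i. P (vars $ i)"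
    and add: "\<And>a b. P a \<Longrightarrow> P b \<Longrightarrow> P (a + b)" and mult: "\<And>a b. P a \<Longrightarrow> P b \<Longrightarrow> P (a * b)"
  shows "P f"
proof -
  have 1: "P [:[:r:]:]" for r
  proof (induction r)
    case 0 then show ?case using c[of 0] by simp
  next
    case (pCons a p)
    have "[:[:pCons a p:]:] = const a + vars $ 1 * [:[:p:]:]" by (simp add: const_def)
    then show ?case using pCons c v add mult by metis
  qed
  have 2: "P [:q:]" for q
  proof (induction q)
    case 0 then show ?case using c[of 0] by simp
  next
    case (pCons a p)
    have "[:pCons a p:] = [:[:a:]:] + vars $ 2 * [:p:]" by simp
    then show ?case using pCons 1 v add mult by metis
  qed
  show ?thesis
  proof (induction f)
    case 0 then show ?case using c[of 0] by simp
  next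
    case (pCons a p)
    have "pCons a p = [:a:] + vars $ 3 * p" by simp
    then show ?case using pCons 2 v add mult by metis
  qed
qed

lemma is_hom_eqI:
  fixes h k :: "tpoly \<Rightarrow> 'a::comm_ring_1"
  assumes "is_hom h" "is_hom k" "\<And>c. h (const c) = k (const c)" "\<And>i. h (vars $ i) = k (vars $ i)"
  shows "h f = k f"
  by (induction f rule: tpoly_induct) (simp_all add: assms is_hom_add is_hom_mult)

lemma is_hom_const: "is_hom const"
  by (rule is_homI) (simp_all add: const_add const_mult)

definition sub :: "(complex \<Rightarrow> 'a::comm_ring_1) \<Rightarrow> 'a^3 \<Rightarrow> tpoly \<Rightarrow> 'a" where
  "sub c v f = poly (map_poly (\<lambda>q. poly (map_poly (\<lambda>r. poly (map_poly c r) (v $ 1)) q) (v $ 2)) f) (v $ 3)"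

lemma is_hom_sub: "is_hom c \<Longrightarrow> is_hom (sub c v)"
  unfolding sub_def[abs_def] by (intro is_hom_eval)

lemma sub_const: "is_hom c \<Longrightarrow> sub c v (const a) = c a"
  by (simp add: sub_def const_def map_poly_pCons is_hom_zero)

lemma sub_var: "is_hom c \<Longrightarrow> sub c v (vars $ i) = v $ i"
  using exhaust_3[of i] by (auto simp: sub_def map_poly_pCons is_hom_zero is_hom_one)

lemma is_hom_ev: "is_hom (\<lambda>f. ev f v)"
  by (rule is_homI) (simp_all add: ev_def)

lemma ev_simps [simp]:
  "ev (a + b) v = ev a v + ev b v" "ev (a * b) v = ev a v * ev b v" "ev 0 v = 0" "ev 1 v = 1"
  "ev (- a) v = - ev a v" "ev (a - b) v = ev a v - ev b v" "ev (const c) v = c"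
  by (simp_all add: ev_def const_def)

lemma ev_var [simp]: "ev (vars $ i) v = v $ i"
  using exhaust_3[of i] by (auto simp: ev_def)

lemma ev_power [simp]: "ev (a ^ n) v = ev a v ^ n"
  by (induction n) simp_all

lemma ev_of_nat [simp]: "ev (of_nat n) v = of_nat n"
  by (induction n) simp_all

lemma poly_zero_if_roots:
  fixes p :: "'a::idom poly" and c :: "complex \<Rightarrow> 'a"
  assumes "\<And>t. poly p (c t) = 0" "inj c"
  shows "p = 0"
proof (rule ccontr)
  assume "p \<noteq> 0"
  then have "finite {x. poly p x = 0}" by (rule poly_roots_finite)
  moreover have "range c \<subseteq> {x. poly p x = 0}" using assms by auto
  ultimately have "finite (range c)" by (rule finite_subset[rotated])
  then show False using \<open>inj c\<close> finite_imageD infinite_UNIV_char_0 by blast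
qed

lemma ev_zeroI:
  assumes "\<And>v. ev f v = 0"
  shows "f = 0"
proof -
  have 1: "poly (poly (poly f [:[:z:]:]) [:y:]) x = 0" for x y z
    using assms[of "vector [x, y, z]"] by (simp add: ev_def vector_3)
  have 2: "poly (poly f [:[:z:]:]) [:y:] = 0" for y z
    by (rule poly_zero_if_roots[where c = "\<lambda>x. x"]) (simp_all add: 1)
  have 3: "poly f [:[:z:]:] = 0" for z
    by (rule poly_zero_if_roots[where c = "\<lambda>x. [:x:]"]) (simp_all add: 2 inj_def)
  show ?thesis by (rule poly_zero_if_roots[where c = "\<lambda>x. [:[:x:]:]"]) (simp_all add: 3 inj_def)
qed

lemma ev_eqI: "(\<And>v. v \<noteq> 0 \<Longrightarrow> ev f v = ev g v) \<Longrightarrow> f = g"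
proof -
  assume h: "\<And>v. v \<noteq> 0 \<Longrightarrow> ev f v = ev g v"
  have "ev (vars $ 1 * (f - g)) v = 0" for v
    using h by (cases "v = 0") (auto simp del: vars_nth)
  then have "vars $ 1 * (f - g) = 0" by (rule ev_zeroI)
  then show ?thesis by auto
qed

section \<open>The grading\<close>

lemma poly_monom_induct [case_names monom add]:
  assumes "\<And>c n. P (monom c n)" "\<And>p q. P p \<Longrightarrow> P q \<Longrightarrow> P (p + q)"
  shows "P (p :: 'a::comm_monoid_add poly)"
proof -
  have "\<forall>n. P (\<Sum>i\<le>n. monom (coeff p i) i)"
  proof
    fix n show "P (\<Sum>i\<le>n. monom (coeff p i) i)"
      by (induction n) (simp_all add: assms)
  qed
  then show ?thesis by (metis poly_as_sum_of_monoms)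
qed

definition monom3 :: "complex \<Rightarrow> nat \<Rightarrow> nat \<Rightarrow> nat \<Rightarrow> tpoly" where
  "monom3 c i j k = monom (monom (monom c i) j) k"

lemma monom3_eq: "monom3 c i j k = const c * vars $ 1 ^ i * vars $ 2 ^ j * vars $ 3 ^ k"
  by (rule ev_eqI) (simp add: monom3_def ev_def const_def poly_monom)

lemma tpoly_monom_induct [case_names monom add]:
  assumes m: "\<And>c i j k. P (monom3 c i j k)" and a: "\<And>f g. P f \<Longrightarrow> P g \<Longrightarrow> P (f + g)"
  shows "P f"
proof (induction f rule: poly_monom_induct)
  case (monom q k)
  show ?case
  proof (induction q rule: poly_monom_induct)
    case (monom r j)
    show ?case
    proof (induction r rule: poly_monom_induct)
      case (monom c i)
      then show ?case using m by (simp add: monom3_def)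
    qed (simp add: a flip: add_monom)
  qed (simp add: a flip: add_monom)
qed (rule a)

definition grade :: "tpoly \<Rightarrow> tpoly poly" where
  "grade = sub (\<lambda>c. [:const c:]) (\<chi> i. [:0, vars $ i:])"

definition homcomp :: "nat \<Rightarrow> tpoly \<Rightarrow> tpoly" where
  "homcomp k f = coeff (grade f) k"

lemma is_hom_const_pCons: "is_hom (\<lambda>c. [:const c:])"
  by (rule is_homI) (simp_all add: const_add const_mult one_pCons)

lemma is_hom_grade: "is_hom grade"
  unfolding grade_def by (intro is_hom_sub is_hom_const_pCons)

lemmas grade_simps [simp] =
  is_hom_zero[OF is_hom_grade] is_hom_one[OF is_hom_grade] is_hom_add[OF is_hom_grade]
  is_hom_mult[OF is_hom_grade]

lemma grade_const [simp]: "grade (const c) = [:const c:]"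
  by (simp add: grade_def sub_const is_hom_const_pCons)

lemma grade_var [simp]: "grade (vars $ i) = [:0, vars $ i:]"
  by (simp add: grade_def sub_var is_hom_const_pCons)

lemma grade_power: "grade (f ^ n) = grade f ^ n"
  by (induction n) simp_all

lemma grade_monom3: "grade (monom3 c i j k) = monom (monom3 c i j k) (i + j + k)"
proof -
  have p: "[:0, a:] ^ n = monom (a ^ n) n" for a :: tpoly and n
    by (induction n) (simp_all add: monom_Suc smult_monom monom_0 one_pCons)
  have "[:const c:] = monom (const c) 0" by (simp add: monom_0)
  then show ?thesis
    by (simp add: monom3_eq grade_power p mult_monom ac_simps del: vars_nth mult_pCons_left)
qed

abbreviation coeff3 :: "tpoly \<Rightarrow> nat \<Rightarrow> nat \<Rightarrow> nat \<Rightarrow> complex" where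
  "coeff3 f i j k \<equiv> coeff (coeff (coeff f k) j) i"

lemma homcomp_0 [simp]: "homcomp k 0 = 0"
  and homcomp_add: "homcomp k (f + g) = homcomp k f + homcomp k g"
  by (simp_all add: homcomp_def)

lemma coeff3_homcomp: "coeff3 (homcomp n f) i j k = (if i + j + k = n then coeff3 f i j k else 0)"
  by (induction f rule: tpoly_monom_induct)
     (auto simp: homcomp_def grade_monom3, auto simp: monom3_def)

lemma coeff3_eqI: "(\<And>i j k. coeff3 f i j k = coeff3 g i j k) \<Longrightarrow> f = g"
  by (intro poly_eqI)

lemma homogeneous_iff_homcomp: "homogeneous d f \<longleftrightarrow> homcomp d f = f"
proof
  assume "homogeneous d f"
  then show "homcomp d f = f"
    by (intro coeff3_eqI) (auto simp: homogeneous_def coeff3_homcomp)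
next
  assume h: "homcomp d f = f"
  show "homogeneous d f"
    unfolding homogeneous_def using coeff3_homcomp[of d f] unfolding h by metis
qed

lemma homogeneous_iff_grade: "homogeneous d f \<longleftrightarrow> grade f = monom f d"
proof
  assume "homogeneous d f"
  then have "homcomp n f = (if n = d then f else 0)" for n
    by (intro coeff3_eqI) (auto simp: homogeneous_def coeff3_homcomp)
  then show "grade f = monom f d"
    by (intro poly_eqI) (auto simp: homcomp_def)
qed (simp add: homogeneous_iff_homcomp homcomp_def)

lemma homogeneous_homcomp: "homogeneous n (homcomp n f)"
  by (auto simp: homogeneous_def coeff3_homcomp split: if_splits)

lemma homcomp_nonzero:
  assumes "f \<noteq> 0"
  obtains k where "homcomp k f \<noteq> 0"
proof -
  obtain i j k where "coeff3 f i j k \<noteq> 0"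
    using assms by (metis coeff3_eqI coeff_0)
  then have "coeff3 (homcomp (i + j + k) f) i j k \<noteq> 0" by (simp add: coeff3_homcomp)
  then show thesis by (intro that[of "i + j + k"]) auto
qed

lemma homogeneous_0 [simp]: "homogeneous d 0"
  and homogeneous_const [simp]: "homogeneous 0 (const c)"
  and homogeneous_1 [simp]: "homogeneous 0 1"
  and homogeneous_var [simp]: "homogeneous 1 (vars $ i)"
  by (simp_all add: homogeneous_iff_grade monom_0 monom_Suc one_pCons[where 'a = tpoly] del: vars_nth)

lemma homogeneous_add: "homogeneous d f \<Longrightarrow> homogeneous d g \<Longrightarrow> homogeneous d (f + g)"
  and homogeneous_mult: "homogeneous d f \<Longrightarrow> homogeneous e g \<Longrightarrow> homogeneous (d + e) (f * g)"
  by (simp_all add: homogeneous_iff_grade add_monom mult_monom)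

lemma homogeneous_power: "homogeneous d f \<Longrightarrow> homogeneous (n * d) (f ^ n)"
  by (induction n) (simp_all add: homogeneous_mult)

lemma homogeneous_const_mult: "homogeneous d f \<Longrightarrow> homogeneous d (const c * f)"
  using homogeneous_mult[of 0 "const c" d f] by simp

lemma homogeneous_minus: "homogeneous d f \<Longrightarrow> homogeneous d (- f)"
  by (simp add: homogeneous_def)

lemma homogeneous_diff: "homogeneous d f \<Longrightarrow> homogeneous d g \<Longrightarrow> homogeneous d (f - g)"
  using homogeneous_add[of d f "- g"] by (simp add: homogeneous_minus)

lemma homogeneous_unique: "homogeneous a f \<Longrightarrow> homogeneous b f \<Longrightarrow> f \<noteq> 0 \<Longrightarrow> a = b"
  by (simp add: homogeneous_iff_grade monom_eq_iff') 

lemma homcomp_mult: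
  assumes "homogeneous d f"
  shows "homcomp k (a * f) = (if k < d then 0 else homcomp (k - d) a * f)"
proof -
  have "grade (a * f) = monom f d * grade a"
    using assms by (metis homogeneous_iff_grade is_hom_grade is_hom_mult mult.commute)
  then show ?thesis unfolding homcomp_def by (simp only: coeff_monom_mult) (simp add: mult.commute)
qed

lemma homogeneous_0_is_const: "homogeneous 0 f \<Longrightarrow> \<exists>c. f = const c"
proof
  assume h: "homogeneous 0 f"
  show "f = const (coeff3 f 0 0 0)"
    using h by (intro coeff3_eqI) (force simp: homogeneous_def const_def coeff_pCons split: nat.split)
qed

lemma homogeneous_induct [consumes 1, case_names zero const var add]:
  assumes "homogeneous d f"
    and z: "\<And>d. P d 0"
    and c: "\<And>c. P 0 (const c)"
    and v: "\<And>d f i. homogeneous d f \<Longrightarrow> P d f \<Longrightarrow> P (Suc d) (vars $ i * f)"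
    and a: "\<And>d f g. homogeneous d f \<Longrightarrow> homogeneous d g \<Longrightarrow> P d f \<Longrightarrow> P d g \<Longrightarrow> P d (f + g)"
  shows "P d f"
proof -
  have vp: "homogeneous (n + e) (vars $ l ^ n * h) \<and> P (n + e) (vars $ l ^ n * h)"
    if "homogeneous e h \<and> P e h" for l n e h
  proof (induction n)
    case (Suc n)
    then show ?case
      using v[of "n + e" "vars $ l ^ n * h" l] homogeneous_mult[OF homogeneous_var[of l], of "n + e" "vars $ l ^ n * h"]
      by (simp add: mult.assoc del: vars_nth)
  qed (use that in simp)
  have m: "P (i + j + k) (monom3 c i j k)" for c i j k
  proof -
    have "monom3 c i j k = vars $ 1 ^ i * (vars $ 2 ^ j * (vars $ 3 ^ k * const c))"
      by (simp add: monom3_eq mult_ac del: vars_nth)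
    then show ?thesis
      using vp[OF vp[OF vp[of 0 "const c" k 3], of j 2], of i 1] c[of c]
      by (simp add: add.assoc del: vars_nth)
  qed
  have "P d (homcomp d g)" for g
  proof (induction g rule: tpoly_monom_induct)
    case (monom c i j k)
    then show ?case using m[of i j k c] z by (auto simp: homcomp_def grade_monom3)
  next
    case (add f g)
    then show ?case by (simp add: homcomp_add a homogeneous_homcomp)
  qed
  then show ?thesis using assms(1) by (metis homogeneous_iff_homcomp)
qed

lemma homogeneous_factor:
  assumes "homogeneous d (f * g)" "f * g \<noteq> 0"
  obtains k where "homogeneous k f"
proof -
  have g: "grade f * grade g = monom (f * g) d"
    using assms(1) by (simp add: homogeneous_iff_grade)
  have nz: "grade f \<noteq> 0" "grade g \<noteq> 0" using g assms(2) by auto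
  have o: "order 0 p \<le> degree p" if "p \<noteq> 0" for p :: "tpoly poly"
    by (rule order_degree[OF that])
  have "order 0 (grade f) + order 0 (grade g) = d"
    using order_mult[of "grade f" "grade g" 0] g nz assms(2) order_0_monom by simp
  moreover have "degree (grade f) + degree (grade g) = d"
    using degree_mult_eq[OF nz] g assms(2) by (simp add: degree_monom_eq)
  ultimately have eq: "order 0 (grade f) = degree (grade f)"
    using o[OF nz(1)] o[OF nz(2)] by linarith
  define n where "n = degree (grade f)"
  obtain q where q: "grade f = [:0, 1:] ^ n * q"
    using order_1[of 0 "grade f"] eq by (auto simp: n_def elim: dvdE)
  have "degree q = 0"
    using n_def nz q by (auto simp: degree_mult_eq degree_linear_power)
  then obtain a where "q = [:a:]" by (metis degree_eq_zeroE)
  then have "grade f = monom a n" using q by (simp add: monom_altdef)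
  moreover have "homcomp n f = f"
  proof (rule coeff3_eqI)
    fix i j k
    show "coeff3 (homcomp n f) i j k = coeff3 f i j k"
      using coeff3_homcomp[of "i + j + k" f k j i] coeff3_homcomp[of n f k j i] \<open>grade f = monom a n\<close>
      by (auto simp: homcomp_def)
  qed
  ultimately show thesis by (intro that[of n]) (simp add: homogeneous_iff_homcomp)
qed



section \<open>Derivations\<close>

definition is_der :: "('a::comm_ring_1 \<Rightarrow> 'a) \<Rightarrow> bool" where
  "is_der \<delta> \<longleftrightarrow> (\<forall>a b. \<delta> (a + b) = \<delta> a + \<delta> b) \<and> (\<forall>a b. \<delta> (a * b) = \<delta> a * b + a * \<delta> b)"

lemma is_der_add: "is_der \<delta> \<Longrightarrow> \<delta> (a + b) = \<delta> a + \<delta> b"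
  and is_der_mult: "is_der \<delta> \<Longrightarrow> \<delta> (a * b) = \<delta> a * b + a * \<delta> b"
  by (auto simp: is_der_def)

lemma is_der_zero: "is_der \<delta> \<Longrightarrow> \<delta> 0 = 0"
  using is_der_add[of \<delta> 0 0] by simp

lemma is_der_pderiv: "is_der (pderiv :: 'a::{comm_ring_1,semiring_no_zero_divisors} poly \<Rightarrow> _)"
  by (simp add: is_der_def pderiv_add pderiv_mult algebra_simps)

lemma is_der_map_poly:
  assumes "is_der \<delta>"
  shows "is_der (map_poly \<delta>)"
proof -
  have s: "\<delta> (sum h A) = (\<Sum>x\<in>A. \<delta> (h x))" for h and A :: "nat set"
    by (induction A rule: infinite_finite_induct) (simp_all add: is_der_zero is_der_add assms)
  show ?thesis
    unfolding is_der_def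
    by (auto intro!: poly_eqI
        simp: coeff_map_poly is_der_zero is_der_add is_der_mult assms coeff_mult s sum.distrib)
qed

definition dotp :: "'a::comm_ring_1^3 \<Rightarrow> 'a^3 \<Rightarrow> 'a" where
  "dotp a b = a $ 1 * b $ 1 + a $ 2 * b $ 2 + a $ 3 * b $ 3"

definition cr :: "'a::comm_ring_1^3 \<Rightarrow> 'a^3 \<Rightarrow> 'a^3" where
  "cr a b = vector [a $ 2 * b $ 3 - a $ 3 * b $ 2, a $ 3 * b $ 1 - a $ 1 * b $ 3,
     a $ 1 * b $ 2 - a $ 2 * b $ 1]"

lemma cr_nth [simp]:
  "cr a b $ 1 = a $ 2 * b $ 3 - a $ 3 * b $ 2"
  "cr a b $ 2 = a $ 3 * b $ 1 - a $ 1 * b $ 3"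
  "cr a b $ 3 = a $ 1 * b $ 2 - a $ 2 * b $ 1"
  by (simp_all add: cr_def vector_3)

lemma vec3_eq_iff: "(a :: 'a^3) = b \<longleftrightarrow> a $ 1 = b $ 1 \<and> a $ 2 = b $ 2 \<and> a $ 3 = b $ 3"
  by (simp add: vec_eq_iff forall_3)

lemma cr_simps:
  "cr (a + b) c = cr a c + cr b c" "cr (a - b) c = cr a c - cr b c"
  "cr a (b + c) = cr a b + cr a c"
  "cr (h *s a) c = h *s cr a c" "cr a (h *s c) = h *s cr a c" "cr a a = 0" "cr 0 a = 0" "cr a 0 = 0"
  by (simp_all add: vec3_eq_iff algebra_simps)

lemma cr_swap: "cr a b = - cr b a"
  by (simp add: vec3_eq_iff algebra_simps)

lemma dotp_simps:
  "dotp (a + b) c = dotp a c + dotp b c" "dotp (a - b) c = dotp a c - dotp b c"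
  "dotp (h *s a) c = h * dotp a c" "dotp a (b + c) = dotp a b + dotp a c" "dotp a (h *s c) = h * dotp a c"
  "dotp 0 a = 0" "dotp a 0 = 0"
  by (simp_all add: dotp_def algebra_simps)

lemma cr_cr: "cr (cr a b) c = dotp a c *s b - dotp b c *s a"
  by (simp add: vec3_eq_iff dotp_def algebra_simps)

lemma dotp_cr: "dotp (cr a b) b = 0" "dotp (cr a b) a = 0"
  by (simp_all add: dotp_def algebra_simps)

definition constv :: "complex^3 \<Rightarrow> tpoly^3" where "constv w = (\<chi> i. const (w $ i))"

lemma constv_nth [simp]: "constv w $ i = const (w $ i)"
  by (simp add: constv_def)

lemma constv_simps:
  "constv 0 = 0" "constv (a + b) = constv a + constv b" "constv (a - b) = constv a - constv b"
  "constv (c *s a) = const c *s constv a"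
  by (simp_all add: vec3_eq_iff const_add const_diff const_mult)

definition grad :: "tpoly \<Rightarrow> tpoly^3" where
  "grad f = vector [partial_x f, partial_y f, partial_z f]"

lemma grad_nth:
  "grad f $ 1 = partial_x f" "grad f $ 2 = partial_y f" "grad f $ 3 = partial_z f"
  by (simp_all add: grad_def vector_3)

lemma is_der_partial: "is_der partial_x" "is_der partial_y" "is_der partial_z"
proof -
  have eq: "partial_x = map_poly (map_poly pderiv)" "partial_y = map_poly pderiv" "partial_z = pderiv"
    by (simp_all add: fun_eq_iff partial_x_def partial_y_def partial_z_def)
  show "is_der partial_x" "is_der partial_y" "is_der partial_z"
    unfolding eq by (intro is_der_map_poly is_der_pderiv)+
qed

lemma is_der_grad: "is_der (\<lambda>f. grad f $ i)"
  using exhaust_3[of i] is_der_partial by (auto simp: grad_nth)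

lemma grad_const [simp]: "grad (const c) = 0"
  by (simp add: vec3_eq_iff grad_nth partial_x_def partial_y_def partial_z_def const_def
      map_poly_pCons pderiv_pCons)

lemma grad_var [simp]: "grad (vars $ i) = axis i 1"
  using exhaust_3[of i]
  by (auto simp: vec3_eq_iff grad_nth partial_x_def partial_y_def partial_z_def axis_def
      map_poly_pCons pderiv_pCons one_pCons)

lemma grad_add: "grad (f + g) = grad f + grad g"
  and grad_mult: "grad (f * g) = g *s grad f + f *s grad g"
  by (simp_all add: vec_eq_iff is_der_add[OF is_der_grad] is_der_mult[OF is_der_grad] algebra_simps)

lemma grad_0 [simp]: "grad 0 = 0"
  using grad_const[of 0] by simp

lemma grad_diff: "grad (f - g) = grad f - grad g"
  using grad_add[of "f - g" g] by simp

lemma dotp_axis: "dotp a (axis i 1) = a $ i" "dotp (axis i 1) a = a $ i"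
  using exhaust_3[of i] by (auto simp: dotp_def axis_def)

lemma euler: "homogeneous d f \<Longrightarrow> dotp vars (grad f) = of_nat d * f"
  by (induction rule: homogeneous_induct)
     (simp_all add: grad_mult grad_add dotp_simps dotp_axis algebra_simps del: vars_nth)

lemma homogeneous_grad: "homogeneous d f \<Longrightarrow> homogeneous (d - 1) (grad f $ i)"
proof (induction rule: homogeneous_induct)
  case (var d f j)
  have "homogeneous d (f * axis j 1 $ i)"
    using var.hyps by (simp add: axis_def)
  moreover have "homogeneous d (vars $ j * grad f $ i)"
  proof (cases d)
    case 0
    then obtain c where "f = const c" using homogeneous_0_is_const var.hyps by blast
    then show ?thesis by simp
  next
    case (Suc e)
    then show ?thesis using homogeneous_mult[OF homogeneous_var var.IH, of j] by (simp del: vars_nth)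
  qed
  ultimately show ?case by (simp add: grad_mult homogeneous_add del: vars_nth)
qed (simp_all add: grad_add homogeneous_add)

definition D :: "complex^3 \<Rightarrow> tpoly \<Rightarrow> tpoly" where "D w f = dotp (constv w) (grad f)"

lemma D_simps:
  "D w (f + g) = D w f + D w g" "D w (f * g) = D w f * g + f * D w g" "D w (const c) = 0"
  "D w (f - g) = D w f - D w g" "D w (vars $ i) = const (w $ i)" "D w 0 = 0"
  by (simp_all add: D_def grad_add grad_mult dotp_simps dotp_axis algebra_simps del: vars_nth)
     (simp add: dotp_def grad_diff algebra_simps)

lemma D_linear: "D (a + b) f = D a f + D b f" "D (c *s a) f = const c * D a f" "D (a - b) f = D a f - D b f"
  by (simp_all add: D_def constv_simps dotp_simps)

lemma D_commute: "D v (D w f) = D w (D v f)"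
  by (induction f rule: tpoly_induct) (simp_all add: D_simps algebra_simps del: vars_nth)

lemma homogeneous_D: "homogeneous d f \<Longrightarrow> homogeneous (d - 1) (D w f)"
  unfolding D_def dotp_def constv_nth
  by (intro homogeneous_add homogeneous_const_mult homogeneous_grad)

lemma ev_D_self: "homogeneous d f \<Longrightarrow> ev (D p f) p = of_nat d * ev f p"
  using arg_cong[OF euler, of d f "\<lambda>h. ev h p"] by (simp add: D_def dotp_def del: vars_nth)

lemma grad_0_imp_0:
  assumes "homogeneous d f" "d \<ge> 1" "grad f = 0"
  shows "f = 0"
proof -
  have "of_nat d * f = 0" using euler[OF assms(1)] assms(3) by (simp add: dotp_simps)
  moreover have "(of_nat d :: tpoly) \<noteq> 0" using assms(2) by simp
  ultimately show ?thesis by (metis mult_eq_0_iff)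
qed

section \<open>The gradient of a reduced form and its Koszul syzygies\<close>

definition coprime3 :: "tpoly^3 \<Rightarrow> bool" where
  "coprime3 F \<longleftrightarrow> (\<forall>q. (\<forall>i. q dvd F $ i) \<longrightarrow> q dvd 1)"

lemma coprime3_nonzero:
  assumes "coprime3 F"
  shows "F \<noteq> 0"
proof
  assume "F = 0"
  then have "0 dvd F $ i" for i by simp
  then have "(0 :: tpoly) dvd 1" using assms unfolding coprime3_def by blast
  then show False by simp
qed

lemma dvd_grad_self_imp_unit:
  assumes "\<And>i. q dvd grad q $ i" "q \<noteq> 0"
  shows "q dvd 1"
proof -
  have deg0: "degree p = 0" if "p dvd pderiv p" for p :: "'a::{idom,semiring_char_0} poly"
  proof (rule ccontr)
    assume n: "degree p \<noteq> 0"
    then have "pderiv p \<noteq> 0" by (simp add: pderiv_eq_0_iff)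
    then show False using dvd_imp_degree_le[OF that] degree_pderiv[of p] n by simp
  qed
  have "degree q = 0" using assms(1)[of 3] by (intro deg0) (simp add: grad_nth partial_z_def)
  then obtain r where r: "q = [:r:]" by (metis degree_eq_zeroE)
  have "r dvd pderiv r" using assms(1)[of 2] by (simp add: grad_nth partial_y_def r map_poly_pCons)
  then have "degree r = 0" by (rule deg0)
  then obtain s where s: "r = [:s:]" by (metis degree_eq_zeroE)
  have "s dvd pderiv s" using assms(1)[of 1] by (simp add: grad_nth partial_x_def r s map_poly_pCons)
  then have "degree s = 0" by (rule deg0)
  then obtain c where c: "s = [:c:]" by (metis degree_eq_zeroE)
  have "q * const (inverse c) = 1" using assms(2) by (simp add: r s c const_def one_pCons)
  then show ?thesis by (metis dvd_triv_left)
qed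

lemma coprime3_grad:
  assumes "reduced_curve d f"
  shows "coprime3 (grad f)"
  unfolding coprime3_def
proof (intro allI impI, rule ccontr)
  fix q assume q: "\<forall>i. q dvd grad f $ i" and nu: "\<not> q dvd 1"
  have h: "homogeneous d f" "d \<ge> 1" "squarefree f" using assms by (auto simp: reduced_curve_def)
  have "f \<noteq> 0" using h(3) by auto
  then have "grad f \<noteq> 0" using grad_0_imp_0 h by blast
  then have "q \<noteq> 0" using q by (auto simp: vec_eq_iff)
  then obtain p where p: "p dvd q" "prime_elem p"
    using nu by (auto elim: prime_divisorE intro: prime_imp_prime_elem)
  have pg: "p dvd grad f $ i" for i using p(1) q by (meson dvd_trans)
  then have "p dvd dotp vars (grad f)" by (simp add: dotp_def del: vars_nth)
  then have "p dvd of_nat d * f" using euler[OF h(1)] by simp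
  then have "p dvd const (inverse (of_nat d)) * (const (of_nat d) * f)"
    by (simp add: const_of_nat)
  also have "\<dots> = const (of_nat d) * const (inverse (of_nat d)) * f" by (simp add: mult_ac)
  also have "\<dots> = f" using h(2) by (simp add: const_inverse)
  finally obtain k where k: "f = p * k" by (elim dvdE)
  have "\<not> p dvd k"
  proof
    assume "p dvd k"
    then obtain m where "k = p * m" by (elim dvdE)
    then have "f = p ^ 2 * m" using k by (simp add: power2_eq_square mult.assoc)
    then have "p ^ 2 dvd f" by (rule dvdI)
    then have "p dvd 1" using h(3) by (intro squarefreeD)
    then show False using p(2) by (simp add: prime_elem_def)
  qed
  moreover have "p dvd grad p $ i * k" for i
  proof -
    have "grad f $ i = k * grad p $ i + p * grad k $ i" by (simp add: k grad_mult)
    then have "grad p $ i * k = grad f $ i - p * grad k $ i" by (simp add: mult.commute)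
    moreover have "p dvd grad f $ i - p * grad k $ i" using pg[of i] by (intro dvd_diff) simp_all
    ultimately show ?thesis by (simp only:)
  qed
  ultimately have "p dvd grad p $ i" for i using p(2) prime_elem_dvd_multD by blast
  moreover have "p \<noteq> 0" "\<not> p dvd 1" using p(2) by (auto simp: prime_elem_def)
  ultimately show False using dvd_grad_self_imp_unit by blast
qed

lemma parallel_coprime3:
  assumes "coprime3 F" "cr a F = 0"
  obtains h where "a = h *s F"
proof -
  have "F \<noteq> 0" using assms(1) by (rule coprime3_nonzero)
  then obtain i where i: "F $ i \<noteq> 0" by (auto simp: vec_eq_iff)
  have e: "a $ j * F $ k = a $ k * F $ j" for j k
  proof -
    have "a $ 2 * F $ 3 = a $ 3 * F $ 2" "a $ 3 * F $ 1 = a $ 1 * F $ 3" "a $ 1 * F $ 2 = a $ 2 * F $ 1"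
      using assms(2) by (simp_all add: vec3_eq_iff)
    then show ?thesis using exhaust_3[of j] exhaust_3[of k] by metis
  qed
  let ?g = "gcd (F $ 1) (gcd (F $ 2) (F $ 3))"
  have "?g dvd F $ j" for j using exhaust_3[of j] by (auto intro: dvd_trans[OF gcd_dvd2])
  then have u: "?g dvd 1" using assms(1) unfolding coprime3_def by blast
  have "F $ i dvd a $ i * F $ j" for j using e[of i j] by (metis dvd_triv_right)
  then have "F $ i dvd gcd (a $ i * F $ 1) (gcd (a $ i * F $ 2) (a $ i * F $ 3))" by simp
  then have "F $ i dvd gcd (a $ i * F $ 1) (a $ i * gcd (F $ 2) (F $ 3))"
    by (simp add: gcd_mult_left)
  then have "F $ i dvd a $ i * ?g" by (simp only: gcd_mult_left dvd_normalize_iff)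
  then have "F $ i dvd a $ i" using u dvd_mult_unit_iff by blast
  then obtain h where h: "a $ i = F $ i * h" by (elim dvdE)
  have "a $ j = h * F $ j" for j
  proof -
    have "F $ i * a $ j = a $ i * F $ j" using e[of i j] by (metis mult.commute)
    also have "\<dots> = F $ i * (h * F $ j)" by (simp only: h mult.assoc)
    finally have "F $ i * a $ j = F $ i * (h * F $ j)" .
    then show ?thesis using i by (metis mult_left_cancel)
  qed
  then show thesis by (intro that[of h]) (simp add: vec_eq_iff)
qed

definition lin :: "complex^3 \<Rightarrow> tpoly" where "lin c = dotp (constv c) vars"

lemma ev_lin [simp]: "ev (lin c) v = dotp c v"
  by (simp add: lin_def dotp_def del: vars_nth)

lemma lin_simps: "lin (a + b) = lin a + lin b" "lin (a - b) = lin a - lin b" "lin (c *s a) = const c * lin a"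
  by (simp_all add: lin_def constv_simps dotp_simps)

lemma lin_axis: "lin (axis i 1) = vars $ i"
  using exhaust_3[of i] by (auto simp: lin_def dotp_def axis_def)

lemma homogeneous_lin: "homogeneous 1 (lin c)"
  unfolding lin_def dotp_def constv_nth
  by (intro homogeneous_add homogeneous_const_mult homogeneous_var)

lemma lin_inj: "lin a = lin b \<Longrightarrow> a = b"
proof -
  assume "lin a = lin b"
  then have "dotp a (axis i 1) = dotp b (axis i 1)" for i by (metis ev_lin)
  then show ?thesis by (simp add: dotp_axis vec_eq_iff)
qed

lemma lin_eq_0_iff: "lin a = 0 \<longleftrightarrow> a = 0"
proof -
  have "lin 0 = 0" by (simp add: lin_def constv_simps dotp_simps)
  then show ?thesis using lin_inj by metis
qed

lemma const_unit: "c \<noteq> 0 \<Longrightarrow> const c dvd 1"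
  by (metis const_inverse dvd_triv_left)

lemma not_unit_homogeneous:
  assumes "homogeneous d f" "d \<ge> 1" "f dvd 1"
  shows False
proof -
  obtain g where g: "1 = f * g" using assms(3) by (elim dvdE)
  then obtain k where k: "homogeneous k g" using homogeneous_factor[of 0 g f] by (auto simp: mult.commute)
  then have "homogeneous (d + k) 1" using homogeneous_mult[OF assms(1) k] g by simp
  then show False using homogeneous_unique[of "d + k" 1 0] assms(2) by simp
qed

lemma prime_elem_lin:
  assumes "a \<noteq> 0"
  shows "prime_elem (lin a)"
proof -
  have "irreducible (lin a)"
  proof (rule irreducibleI)
    show "lin a \<noteq> 0" using assms by (simp add: lin_eq_0_iff)
    show "\<not> lin a dvd 1" using not_unit_homogeneous[OF homogeneous_lin] by auto
    fix f g assume e: "lin a = f * g"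
    have nz: "f * g \<noteq> 0" using assms e by (simp add: lin_eq_0_iff flip: e)
    have h: "homogeneous 1 (f * g)" using homogeneous_lin[of a] e by simp
    obtain k where k: "homogeneous k f" using homogeneous_factor[OF h nz] .
    obtain l where l: "homogeneous l g" using homogeneous_factor[of 1 g f] h nz by (metis mult.commute)
    have "k + l = 1" using homogeneous_unique[OF homogeneous_mult[OF k l] h nz] .
    then consider "k = 0" | "l = 0" by linarith
    then show "f dvd 1 \<or> g dvd 1"
      using homogeneous_0_is_const[of f] homogeneous_0_is_const[of g] k l nz const_unit by cases auto
  qed
  then show ?thesis by (rule irreducible_imp_prime_elem)
qed

lemma lin_dvd_multD:
  assumes "cr a b \<noteq> 0" "lin a dvd lin b * h"
  shows "lin a dvd h"
proof -
  have nz: "a \<noteq> 0" "b \<noteq> 0" using assms(1) by (auto simp: cr_simps)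
  have "\<not> lin a dvd lin b"
  proof
    assume "lin a dvd lin b"
    then obtain q where q: "lin b = q * lin a" by (metis dvdE mult.commute)
    have nz': "q * lin a \<noteq> 0" using nz q by (metis lin_eq_0_iff)
    obtain k where k: "homogeneous k q" using homogeneous_factor[of 1 q "lin a"] nz' homogeneous_lin[of b] q by auto
    have "homogeneous (k + 1) (q * lin a)" "homogeneous 1 (q * lin a)"
      using homogeneous_mult[OF k homogeneous_lin[of a]] homogeneous_lin[of b] q by auto
    then have "k + 1 = 1" using nz' homogeneous_unique by blast
    then obtain c where "q = const c" using k homogeneous_0_is_const by auto
    then have "lin b = lin (c *s a)" using q by (simp add: lin_simps)
    then have "b = c *s a" by (rule lin_inj)
    then show False using assms(1) by (simp add: cr_simps)
  qed
  then show ?thesis using assms(2) prime_elem_lin[OF nz(1)] prime_elem_dvd_multD by blast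
qed

definition koszul :: "tpoly^3 \<Rightarrow> (tpoly^3) set" where "koszul F = range (\<lambda>a. cr a F)"

lemma koszul_add: "u \<in> koszul F \<Longrightarrow> v \<in> koszul F \<Longrightarrow> u + v \<in> koszul F"
  and koszul_diff: "u \<in> koszul F \<Longrightarrow> v \<in> koszul F \<Longrightarrow> u - v \<in> koszul F"
  and koszul_scale: "u \<in> koszul F \<Longrightarrow> h *s u \<in> koszul F"
  unfolding koszul_def by (force simp: image_iff simp flip: cr_simps)+

lemma koszul_0: "0 \<in> koszul F"
  unfolding koszul_def by (rule range_eqI[of _ _ 0]) (simp add: cr_simps)

lemma koszul_unscale: "c \<noteq> 0 \<Longrightarrow> const c *s u \<in> koszul F \<Longrightarrow> u \<in> koszul F"
  using koszul_scale[of "const c *s u" F "const (inverse c)"] const_inverse[of c]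
  by (simp add: mult.commute)

lemma gradient_ideal_kills:
  assumes "dotp \<rho> F = 0"
  shows "dotp a F *s \<rho> \<in> koszul F"
  using cr_cr[of a \<rho> F] assms by (auto simp: koszul_def intro: range_eqI[of _ _ "cr a \<rho>"])

lemma vars_syzygy:
  assumes "dotp h vars = 0"
  obtains b where "h = cr b vars"
proof -
  obtain r1 q1 where 1: "h $ 1 = pCons r1 q1" by (metis pCons_cases)
  obtain r2 q2 where 2: "h $ 2 = pCons r2 q2" by (metis pCons_cases)
  obtain c1 s where s: "r1 = pCons c1 s" by (metis pCons_cases)
  have z: "pCons (smult [:0, 1:] r1 + pCons 0 r2) (smult [:[:0, 1:]:] q1 + smult [:0, 1:] q2 + h $ 3) = 0"
    using assms by (simp add: dotp_def 1 2 algebra_simps)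
  then have e: "smult [:0, 1:] r1 + pCons 0 r2 = 0" "smult [:[:0, 1:]:] q1 + smult [:0, 1:] q2 + h $ 3 = 0"
    by simp_all
  have r: "c1 = 0" "r2 = - smult [:0, 1:] s" using e(1) by (simp_all add: s eq_neg_iff_add_eq_0 add.commute)
  have h3: "h $ 3 = - smult [:[:0, 1:]:] q1 - smult [:0, 1:] q2" using e(2) by (simp add: algebra_simps eq_neg_iff_add_eq_0)
  show thesis
    by (rule that[of "vector [- q2, q1, - [:s:]]"]) (simp add: vec3_eq_iff vector_3 1 2 s r h3)
qed

lemma koszul_saturated_vars:
  assumes F: "coprime3 F" and u: "\<And>i. vars $ i *s u \<in> koszul F"
  shows "u \<in> koszul F"
proof -
  have "\<forall>i. \<exists>a. vars $ i *s u = cr a F" using u by (auto simp: koszul_def simp del: vars_nth)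
  then obtain \<alpha> where \<alpha>: "vars $ i *s u = cr (\<alpha> i) F" for i by metis
  have "\<exists>h. vars $ j *s \<alpha> i - vars $ i *s \<alpha> j = h *s F" for i j
  proof -
    have "cr (vars $ j *s \<alpha> i - vars $ i *s \<alpha> j) F = 0"
      by (simp add: cr_simps mult.commute del: vars_nth flip: \<alpha>)
    then show ?thesis using parallel_coprime3[OF F] by metis
  qed
  then have "\<forall>ij. \<exists>h. vars $ snd ij *s \<alpha> (fst ij) - vars $ fst ij *s \<alpha> (snd ij) = h *s F"
    by blast
  from choice[OF this] obtain h' where
    "\<And>ij. vars $ snd ij *s \<alpha> (fst ij) - vars $ fst ij *s \<alpha> (snd ij) = h' ij *s F"
    by blast
  from this[of "(_, _)"] obtain h where h: "\<And>i j. vars $ j *s \<alpha> i - vars $ i *s \<alpha> j = h i j *s F"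
    by (intro that[of "\<lambda>i j. h' (i, j)"]) simp
  define H where "H = (vector [h 2 3, - h 1 3, h 1 2] :: tpoly^3)"
  have "dotp H vars *s F = 0"
  proof -
    have "dotp H vars *s F = vars $ 1 *s (h 2 3 *s F) - vars $ 2 *s (h 1 3 *s F) + vars $ 3 *s (h 1 2 *s F)"
      by (simp add: H_def dotp_def vector_3 vec_eq_iff algebra_simps del: vars_nth)
    also have "\<dots> = 0" unfolding h[symmetric] by (simp add: vec_eq_iff algebra_simps del: vars_nth)
    finally show ?thesis .
  qed
  then have "dotp H vars = 0" using coprime3_nonzero[OF F] by (auto simp: vec_eq_iff)
  then obtain b where b: "H = cr b vars" by (rule vars_syzygy)
  have h12: "h 1 2 = b $ 1 * vars $ 2 - b $ 2 * vars $ 1"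
    using b by (simp add: vec3_eq_iff H_def vector_3 del: vars_nth)
  define \<beta> where "\<beta> i = \<alpha> i - b $ i *s F" for i
  have "vars $ 2 *s \<beta> 1 = vars $ 1 *s \<beta> 2"
    using h[of 2 1] unfolding h12 by (simp add: \<beta>_def vec_eq_iff algebra_simps del: vars_nth)
  then have "vars $ 1 dvd vars $ 2 * \<beta> 1 $ k" for k
    by (metis dvd_triv_left vector_smult_component)
  then have "vars $ 1 dvd \<beta> 1 $ k" for k
  proof -
    have "cr (axis 1 1) (axis 2 1) \<noteq> (0 :: complex^3)" by (simp add: vec3_eq_iff axis_def)
    from lin_dvd_multD[OF this] show ?thesis
      using \<open>\<And>k. vars $ 1 dvd vars $ 2 * \<beta> 1 $ k\<close> unfolding lin_axis by blast
  qed
  then have "\<forall>k. \<exists>c. \<beta> 1 $ k = vars $ 1 * c" by (auto elim!: dvdE simp del: vars_nth)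
  then obtain c where "\<And>k. \<beta> 1 $ k = vars $ 1 * c k" by metis
  then have c: "\<beta> 1 = vars $ 1 *s (\<chi> k. c k)" by (simp add: vec_eq_iff del: vars_nth)
  have "vars $ 1 *s u = cr (\<beta> 1) F" by (simp add: \<beta>_def cr_simps \<alpha> del: vars_nth)
  then have "vars $ 1 *s (u - cr (\<chi> k. c k) F) = 0" unfolding c
    by (simp add: cr_simps vec_eq_iff algebra_simps del: vars_nth)
  then have "vars $ 1 * (u - cr (\<chi> k. c k) F) $ i = 0" for i
    by (metis vector_smult_component zero_index)
  then have "(u - cr (\<chi> k. c k) F) $ i = 0" for i by (metis mult_eq_0_iff lin_axis lin_eq_0_iff axis_eq_0_iff zero_neq_one)
  then have "u = cr (\<chi> k. c k) F" by (simp add: vec_eq_iff)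
  then show ?thesis by (simp add: koszul_def)
qed

lemma dotp_normalized:
  assumes "p \<noteq> (0 :: complex^3)"
  obtains t where "dotp t p = 1"
proof -
  obtain i where "p $ i \<noteq> 0" using assms by (auto simp: vec_eq_iff)
  then have "dotp ((1 / p $ i) *s axis i 1) p = 1" by (simp add: dotp_simps dotp_axis)
  then show thesis by (rule that)
qed

lemma form_mod_point_ideal:
  assumes add: "\<And>a b. a \<in> I \<Longrightarrow> b \<in> I \<Longrightarrow> a + b \<in> I" and mult: "\<And>h a. a \<in> I \<Longrightarrow> h * a \<in> I"
    and lin: "\<And>c. dotp c p = 0 \<Longrightarrow> lin c \<in> I"
    and t: "dotp t p = 1" and s: "homogeneous k s"
  shows "s - const (ev s p) * lin t ^ k \<in> I"
proof -
  have v: "vars $ i - const (p $ i) * lin t \<in> I" for i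
    using lin[of "axis i 1 - p $ i *s t"] t
    by (simp add: lin_simps lin_axis dotp_simps dotp_axis del: vars_nth)
  have z: "0 \<in> I" using mult[OF v, of 0] by simp
  show ?thesis using s
  proof (induction rule: homogeneous_induct)
    case (var d f i)
    have "vars $ i * f - const (ev (vars $ i * f) p) * lin t ^ Suc d =
        vars $ i * (f - const (ev f p) * lin t ^ d)
        + (const (ev f p) * lin t ^ d) * (vars $ i - const (p $ i) * lin t)"
      by (simp add: const_mult algebra_simps del: vars_nth)
    then show ?case using add[OF mult mult] var.IH v by metis
  next
    case (add d f g)
    then show ?case using assms(1)[OF add.IH] by (simp add: const_add algebra_simps)
  qed (simp_all add: z)
qed

lemma koszul_saturated:
  assumes F: "coprime3 F" and p: "p \<noteq> 0"
    and c: "\<And>c. dotp c p = 0 \<Longrightarrow> lin c *s u \<in> koszul F"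
    and s: "homogeneous k s" "ev s p \<noteq> 0" "s *s u \<in> koszul F"
  shows "u \<in> koszul F"
proof -
  obtain t where t: "dotp t p = 1" using dotp_normalized[OF p] .
  have v: "(vars $ i - const (p $ i) * lin t) *s u \<in> koszul F" for i
    using c[of "axis i 1 - p $ i *s t"] t by (simp add: lin_simps lin_axis dotp_simps dotp_axis del: vars_nth)
  have "s - const (ev s p) * lin t ^ k \<in> {h. h *s u \<in> koszul F}"
    by (rule form_mod_point_ideal[OF _ _ _ t s(1)])
       (auto simp: vector_sadd_rdistrib c intro: koszul_add simp flip: vector_smult_assoc intro: koszul_scale)
  then have "(s - const (ev s p) * lin t ^ k) *s u \<in> koszul F" by simp
  from koszul_diff[OF s(3) this] have "const (ev s p) *s (lin t ^ k *s u) \<in> koszul F"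
    by (simp add: vector_sub_rdistrib)
  then have "lin t ^ k *s u \<in> koszul F" using koszul_unscale s(2) by blast
  then show ?thesis
  proof (induction k)
    case (Suc k)
    have "vars $ i *s (lin t ^ k *s u) \<in> koszul F" for i
    proof -
      have "vars $ i *s (lin t ^ k *s u) = lin t ^ k *s ((vars $ i - const (p $ i) * lin t) *s u)
          + const (p $ i) *s (lin t ^ Suc k *s u)"
        by (simp add: vec_eq_iff algebra_simps del: vars_nth)
      then show ?thesis using koszul_add[OF koszul_scale koszul_scale] v Suc.prems by metis
    qed
    then show ?case using koszul_saturated_vars[OF F] Suc.IH by blast
  qed simp
qed



section \<open>Elimination and points of the singular scheme\<close>

lemma ev_sub: "ev (sub const w f) v = ev f (\<chi> i. ev (w $ i) v)"
proof (rule is_hom_eqI[where h = "\<lambda>f. ev (sub const w f) v"])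
  show "is_hom (\<lambda>f. ev (sub const w f) v)"
    by (rule is_homI) (simp_all add: is_hom_one is_hom_add is_hom_mult is_hom_sub is_hom_const)
qed (simp_all add: is_hom_ev sub_const sub_var is_hom_const del: vars_nth)

lemma sub_dvd_diff:
  assumes "\<And>i. m dvd a $ i - b $ i"
  shows "m dvd sub const a f - sub const b f"
proof (induction f rule: tpoly_induct)
  case (add f g)
  have "m dvd (sub const a f - sub const b f) + (sub const a g - sub const b g)"
    by (rule dvd_add) (rule add.IH)+
  then show ?case by (simp add: is_hom_add is_hom_sub is_hom_const algebra_simps)
next
  case (mult f g)
  have "m dvd sub const a g * (sub const a f - sub const b f) + sub const b f * (sub const a g - sub const b g)"
    by (intro dvd_add dvd_mult mult.IH)
  then show ?case by (simp add: is_hom_mult is_hom_sub is_hom_const algebra_simps)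
qed (simp_all add: assms sub_const sub_var is_hom_const del: vars_nth)

lemma sub_vars: "sub const vars f = f"
  by (rule ev_eqI) (simp add: ev_sub del: vars_nth)

lemma elimination:
  assumes F: "coprime3 F"
  obtains r a where "r \<noteq> 0" "[:r:] = dotp a F"
proof -
  define I where "I = {dotp a F | a. True}"
  have Isub: "x - h * y \<in> I" if xy: "x \<in> I" "y \<in> I" for x y h
  proof -
    obtain a b where "x = dotp a F" "y = dotp b F" using xy unfolding I_def by blast
    then have "x - h * y = dotp (a - h *s b) F" by (simp add: dotp_simps)
    then show ?thesis by (auto simp: I_def)
  qed
  have FI: "F $ i \<in> I" for i using dotp_axis(2)[of i F] by (auto simp: I_def intro!: exI[of _ "axis i 1"])
  have "0 \<in> I" using Isub[OF FI FI, of _ 1] by (metis diff_self mult_1)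
  obtain i where i: "F $ i \<noteq> 0" using coprime3_nonzero[OF F] by (auto simp: vec_eq_iff)
  obtain R where R: "R \<in> I" "R \<noteq> 0" and min: "\<And>S. S \<in> I \<Longrightarrow> S \<noteq> 0 \<Longrightarrow> degree R \<le> degree S"
    using ex_has_least_nat[of "\<lambda>R. R \<in> I \<and> R \<noteq> 0" "F $ i" degree] i FI by blast
  have dv: "primitive_part R dvd F $ j" for j
  proof -
    obtain q r where qr: "pseudo_divmod (F $ j) R = (q, r)" by (metis surj_pair)
    define c where "c = coeff R (degree R) ^ (Suc (degree (F $ j)) - degree R)"
    have c: "c \<noteq> 0" using R(2) by (simp add: c_def)
    have e: "smult c (F $ j) = R * q + r" and r: "r = 0 \<or> degree r < degree R"
      using pseudo_divmod[OF R(2) qr] by (simp_all add: c_def)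
    have "smult c (F $ j) \<in> I"
      using Isub[OF \<open>0 \<in> I\<close> FI[of j], of "[:- c:]"] by simp
    then have "r \<in> I" using Isub[OF _ R(1), of "smult c (F $ j)" q] e by (simp add: mult.commute)
    then have "r = 0" using min r by force
    then have e': "smult c (F $ j) = primitive_part R * smult (content R) q"
      using e by (metis add_0_right content_times_primitive_part mult_smult_left mult_smult_right)
    define q' where "q' = smult (content R) q"
    have "c dvd content (smult c (F $ j))" by simp
    then have "c dvd content (primitive_part R * q')" using e' by (simp add: q'_def)
    then have "c dvd content q'" using R(2) by (simp add: content_mult)
    then have "[:c:] dvd q'" by (simp add: const_poly_dvd_iff_dvd_content)
    then obtain q'' where q'': "q' = smult c q''" by (auto elim!: dvdE)
    have "smult c (F $ j) = smult c (primitive_part R * q'')" using e' by (simp add: q'' flip: q'_def)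
    then have "F $ j = primitive_part R * q''" using c by (metis smult_cancel)
    then show ?thesis by (rule dvdI)
  qed
  then have "primitive_part R dvd 1" using F unfolding coprime3_def by blast
  then have "degree (primitive_part R) = 0" by (metis degree_pCons_0 is_unit_poly_iff)
  then have "degree R = 0" by (simp only: degree_primitive_part)
  then obtain r where "R = [:r:]" by (metis degree_eq_zeroE)
  then show thesis using that R by (auto simp: I_def)
qed

definition hompoly :: "nat \<Rightarrow> complex poly \<Rightarrow> tpoly \<Rightarrow> tpoly \<Rightarrow> tpoly" where
  "hompoly N w X Y = (\<Sum>j\<le>N. const (coeff w j) * X ^ (N - j) * Y ^ j)"

lemma hompoly_add: "hompoly N (v + w) X Y = hompoly N v X Y + hompoly N w X Y"
  by (simp add: hompoly_def const_add algebra_simps sum.distrib)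

lemma hompoly_smult: "hompoly N (smult c w) X Y = const c * hompoly N w X Y"
  by (simp add: hompoly_def const_mult algebra_simps sum_distrib_left)

lemma hompoly_Suc: "degree w \<le> N \<Longrightarrow> hompoly (Suc N) w X Y = X * hompoly N w X Y"
  by (simp add: hompoly_def coeff_eq_0 sum_distrib_left Suc_diff_le algebra_simps)

lemma hompoly_pCons_0: "hompoly (Suc N) (pCons 0 w) X Y = Y * hompoly N w X Y"
  unfolding hompoly_def sum.atMost_Suc_shift by (simp add: sum_distrib_left algebra_simps)

lemma hompoly_mult_linear:
  assumes "degree w \<le> N"
  shows "hompoly (Suc N) ([:a, b:] * w) X Y = (const a * X + const b * Y) * hompoly N w X Y"
proof -
  have "[:a, b:] * w = smult a w + pCons 0 (smult b w)" by simp
  then show ?thesis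
    using assms by (simp only: hompoly_add hompoly_pCons_0 hompoly_smult hompoly_Suc) (simp add: algebra_simps)
qed

definition along_line :: "complex^3 \<Rightarrow> complex^3 \<Rightarrow> tpoly \<Rightarrow> complex poly" where
  "along_line u v = sub (\<lambda>c. [:c:]) (\<chi> i. [:u $ i, v $ i:])"

lemma is_hom_pCons: "is_hom (\<lambda>c :: complex. [:c:])"
  by (rule is_homI) (simp_all add: one_pCons)

lemma is_hom_along_line: "is_hom (along_line u v)"
  unfolding along_line_def by (intro is_hom_sub is_hom_pCons)

lemma poly_along_line: "poly (along_line u v f) t = ev f (u + t *s v)"
proof (rule is_hom_eqI[where h = "\<lambda>f. poly (along_line u v f) t"])
  show "is_hom (\<lambda>f. poly (along_line u v f) t)"
    by (rule is_homI) (simp_all add: is_hom_one is_hom_add is_hom_mult is_hom_along_line)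
qed (simp_all add: is_hom_ev along_line_def sub_const sub_var is_hom_pCons algebra_simps del: vars_nth)

lemma homogeneous_along_line:
  assumes "homogeneous N f"
  shows "degree (along_line u v f) \<le> N \<and>
    sub const (X *s constv u + Y *s constv v) f = hompoly N (along_line u v f) X Y"
  using assms
proof (induction rule: homogeneous_induct)
  case (zero d)
  show ?case by (simp add: is_hom_zero[OF is_hom_along_line] is_hom_zero[OF is_hom_sub[OF is_hom_const]] hompoly_def)
next
  case (const c)
  show ?case by (simp add: along_line_def sub_const is_hom_pCons is_hom_const hompoly_def)
next
  case (var d f i)
  have l: "along_line u v (vars $ i * f) = [:u $ i, v $ i:] * along_line u v f"
    by (simp only: is_hom_mult[OF is_hom_along_line]) (simp add: along_line_def sub_var is_hom_pCons del: vars_nth)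
  have "degree (along_line u v (vars $ i * f)) \<le> degree [:u $ i, v $ i:] + degree (along_line u v f)"
    unfolding l by (rule degree_mult_le)
  also have "\<dots> \<le> Suc d" using var.IH by simp
  finally show ?case unfolding l hompoly_mult_linear[OF conjunct1[OF var.IH]]
    using var.IH by (simp add: is_hom_mult[OF is_hom_sub[OF is_hom_const]] sub_var is_hom_const mult.commute del: vars_nth)
next
  case (add d f g)
  then show ?case
    by (simp add: is_hom_add[OF is_hom_along_line] is_hom_add[OF is_hom_sub[OF is_hom_const]] hompoly_add degree_add_le)
qed

lemma binary_form_linear_factor:
  assumes "w \<noteq> 0" "degree w \<le> N" "hompoly N w X Y *s \<rho> \<in> koszul F" "\<rho> \<notin> koszul F"
  shows "\<exists>h a b. h *s \<rho> \<notin> koszul F \<and> (a \<noteq> 0 \<or> b \<noteq> 0) \<and> (const a * X + const b * Y) *s (h *s \<rho>) \<in> koszul F"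
  using assms
proof (induction N arbitrary: w)
  case 0
  then obtain c where "w = [:c:]" by (metis degree_eq_zeroE le_zero_eq)
  then show ?case using 0 koszul_unscale by (auto simp: hompoly_def)
next
  case (Suc N)
  obtain a b v where v: "v \<noteq> 0" "degree v \<le> N" "w = [:a, b:] * v" "a \<noteq> 0 \<or> b \<noteq> 0"
  proof (cases "degree w \<le> N")
    case True
    then show ?thesis using that[of w 1 0] Suc.prems by simp
  next
    case False
    then have "\<not> constant (poly w)" by (simp add: constant_degree)
    then obtain t where "poly w t = 0" using fundamental_theorem_of_algebra by blast
    then obtain v where v: "w = [:- t, 1:] * v" by (auto simp: poly_eq_0_iff_dvd elim: dvdE)
    have "v \<noteq> 0" using v Suc.prems(1) by auto
    then have "degree w = Suc (degree v)" unfolding v by (subst degree_mult_eq) auto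
    then show ?thesis using that[of v "- t" 1] v \<open>v \<noteq> 0\<close> Suc.prems(2) by simp
  qed
  have *: "(const a * X + const b * Y) *s (hompoly N v X Y *s \<rho>) \<in> koszul F"
    using Suc.prems(3) unfolding v(3) hompoly_mult_linear[OF v(2)] by simp
  show ?case
  proof (cases "hompoly N v X Y *s \<rho> \<in> koszul F")
    case True
    then show ?thesis using Suc.IH v Suc.prems(4) by blast
  next
    case False
    then show ?thesis using * v(4) by blast
  qed
qed

lemma orthogonal_cross_span:
  assumes "cr a b \<noteq> (0 :: complex^3)" "dotp c (cr a b) = 0"
  obtains s t where "c = s *s a + t *s b"
proof -
  note outer = that
  have d: "c $ 1 * (a $ 2 * b $ 3 - a $ 3 * b $ 2) + c $ 2 * (a $ 3 * b $ 1 - a $ 1 * b $ 3)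
      + c $ 3 * (a $ 1 * b $ 2 - a $ 2 * b $ 1) = 0"
    using assms(2) by (simp add: dotp_def)
  have fin: thesis if "\<Delta> \<noteq> 0" "\<Delta> *s c = s *s a + t *s b" for \<Delta> s t
  proof -
    have "c = inverse \<Delta> *s (\<Delta> *s c)" using that(1) by simp
    also have "\<dots> = (inverse \<Delta> * s) *s a + (inverse \<Delta> * t) *s b"
      unfolding that(2) by (simp add: vector_add_ldistrib)
    finally show thesis by (rule outer)
  qed
  consider "a $ 2 * b $ 3 - a $ 3 * b $ 2 \<noteq> 0" | "a $ 3 * b $ 1 - a $ 1 * b $ 3 \<noteq> 0"
    | "a $ 1 * b $ 2 - a $ 2 * b $ 1 \<noteq> 0"
    using assms(1) by (auto simp: vec3_eq_iff)
  then show thesis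
  proof cases
    case 1
    show thesis
      by (rule fin[OF 1, of "c $ 2 * b $ 3 - c $ 3 * b $ 2" "a $ 2 * c $ 3 - a $ 3 * c $ 2"])
         (use d in \<open>simp add: vec3_eq_iff, algebra\<close>)
  next
    case 2
    show thesis
      by (rule fin[OF 2, of "c $ 3 * b $ 1 - c $ 1 * b $ 3" "a $ 3 * c $ 1 - a $ 1 * c $ 3"])
         (use d in \<open>simp add: vec3_eq_iff, algebra\<close>)
  next
    case 3
    show thesis
      by (rule fin[OF 3, of "c $ 1 * b $ 2 - c $ 2 * b $ 1" "a $ 1 * c $ 2 - a $ 2 * c $ 1"])
         (use d in \<open>simp add: vec3_eq_iff, algebra\<close>)
  qed
qed

lemma homogeneous_gradient_ideal:
  assumes "\<And>i. homogeneous e (F $ i)"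
  obtains b where "homcomp k (dotp a F) = dotp b F"
proof (cases "k < e")
  case True
  then show ?thesis by (intro that[of 0]) (simp add: dotp_def homcomp_add homcomp_mult[OF assms])
next
  case False
  then show ?thesis
    by (intro that[of "\<chi> i. homcomp (k - e) (a $ i)"])
       (simp add: dotp_def homcomp_add homcomp_mult[OF assms])
qed

text \<open>A weak Nullstellensatz: a nonzero submodule of the syzygies modulo the Koszul ones has an
  associated point. A form \<open>r(x,y)\<close> in the gradient ideal provides a first linear form, and the
  restriction of the gradient ideal to the corresponding line a second one.\<close>

lemma syzygy_associated_point:
  assumes F: "coprime3 F" "\<And>i. homogeneous e (F $ i)" and \<rho>: "dotp \<rho> F = 0" "\<rho> \<notin> koszul F"
  obtains h p where "p \<noteq> 0" "\<And>i. ev (F $ i) p = 0" "h *s \<rho> \<notin> koszul F"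
    "\<And>c. dotp c p = 0 \<Longrightarrow> lin c *s (h *s \<rho>) \<in> koszul F"
proof -
  obtain r a where r: "r \<noteq> 0" "[:r:] = dotp a F" using elimination[OF F(1)] .
  obtain k where k: "homcomp k [:r:] \<noteq> 0" using homcomp_nonzero[of "[:r:]"] r(1) by auto
  define R where "R = homcomp k [:r:]"
  obtain a' where a': "R = dotp a' F" unfolding R_def r(2) using homogeneous_gradient_ideal[OF F(2)] .
  define u where "u = (axis 1 1 :: complex^3)"
  define v where "v = (axis 2 1 :: complex^3)"
  have "coeff R n = 0" if "n \<noteq> 0" for n
  proof -
    have "coeff3 R i j n = 0" for i j using that by (simp add: R_def coeff3_homcomp coeff_pCons split: nat.split)
    then show ?thesis by (intro poly_eqI) simp
  qed
  then have "degree R = 0" by (metis leading_coeff_0_iff degree_0)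
  then obtain r' where r': "R = [:r':]" by (metis degree_eq_zeroE)
  have R: "sub const (vars $ 1 *s constv u + vars $ 2 *s constv v) R = R"
    by (rule ev_eqI) (simp add: ev_sub, simp add: r' ev_def u_def v_def axis_def)
  define w where "w = along_line u v R"
  have w: "degree w \<le> k" "R = hompoly k w (vars $ 1) (vars $ 2)"
    using homogeneous_along_line[of k R u v] R by (simp_all add: w_def R_def homogeneous_homcomp)
  have "w \<noteq> 0" using w(2) k by (auto simp: hompoly_def R_def)
  moreover have "hompoly k w (vars $ 1) (vars $ 2) *s \<rho> \<in> koszul F"
    unfolding w(2)[symmetric] a' by (rule gradient_ideal_kills[OF \<rho>(1)])
  ultimately obtain h1 a b where ab: "h1 *s \<rho> \<notin> koszul F" "a \<noteq> 0 \<or> b \<noteq> 0"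
      "(const a * vars $ 1 + const b * vars $ 2) *s (h1 *s \<rho>) \<in> koszul F"
    using binary_form_linear_factor w(1) \<rho>(2) by blast
  define \<rho>1 where "\<rho>1 = h1 *s \<rho>"
  define c1 where "c1 = (vector [a, b, 0] :: complex^3)"
  define m where "m = lin c1"
  have "m = const a * vars $ 1 + const b * vars $ 2"
    by (simp add: m_def lin_def dotp_def c1_def vector_3 del: vars_nth)
  then have m: "m *s \<rho>1 \<in> koszul F" using ab(3) by (simp add: \<rho>1_def)
  have \<rho>1: "\<rho>1 \<notin> koszul F" "dotp \<rho>1 F = 0" using ab(1) \<rho>(1) by (simp_all add: \<rho>1_def dotp_simps)
  have "c1 \<noteq> 0" using ab(2) by (auto simp: c1_def vec3_eq_iff vector_3)
  define x where "x = (if a \<noteq> 0 then vector [0, - inverse a, 0] else vector [inverse b, 0, 0] :: complex^3)"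
  define u where "u = (vector [b, - a, 0] :: complex^3)"
  define v where "v = (axis 3 1 :: complex^3)"
  let ?s = "lin x *s constv u + vars $ 3 *s constv v"
  have dv: "m dvd vars $ i - ?s $ i" for i
  proof -
    note [simp del] = vars_nth
    have uv: "u $ 1 = b" "u $ 2 = - a" "u $ 3 = 0" "v $ 1 = 0" "v $ 2 = 0" "v $ 3 = 1"
      by (simp_all add: u_def v_def vector_3 axis_def)
    have mev: "ev m y = a * y $ 1 + b * y $ 2" for y
      by (simp add: m_def c1_def dotp_def vector_3)
    have "\<exists>q. \<forall>y. ev (vars $ i - ?s $ i) y = ev (m * const q) y"
    proof (cases "a = 0")
      case True
      then have "dotp x y = inverse b * y $ 1" for y by (simp add: x_def dotp_def vector_3)
      moreover have "b \<noteq> 0" using ab(2) True by simp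
      ultimately show ?thesis
        using exhaust_3[of i]
        by (intro exI[of _ "if i = 2 then inverse b else 0"]) (auto simp: uv mev True)
    next
      case False
      then have "dotp x y = - inverse a * y $ 2" for y by (simp add: x_def dotp_def vector_3)
      then show ?thesis
        using exhaust_3[of i] False
        by (intro exI[of _ "if i = 1 then inverse a else 0"]) (auto simp: uv mev algebra_simps)
    qed
    then show ?thesis using ev_eqI by (metis dvd_triv_left)
  qed
  have "\<exists>i. along_line u v (F $ i) \<noteq> 0"
  proof (rule ccontr)
    assume "\<not> ?thesis"
    then have "sub const ?s (F $ i) = 0" for i
      using homogeneous_along_line[OF F(2)[of i], where X = "lin x" and Y = "vars $ 3" and u = u and v = v] by (simp add: hompoly_def)
    then have "m dvd F $ i" for i using sub_dvd_diff[of m vars ?s "F $ i"] dv by (simp add: sub_vars)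
    then have "m dvd 1" using F(1) unfolding coprime3_def by blast
    then show False using not_unit_homogeneous[OF homogeneous_lin] unfolding m_def by auto
  qed
  then obtain i where i: "along_line u v (F $ i) \<noteq> 0" by blast
  let ?w = "along_line u v (F $ i)"
  have w: "degree ?w \<le> e" "sub const ?s (F $ i) = hompoly e ?w (lin x) (vars $ 3)"
    using homogeneous_along_line[OF F(2)] by blast+
  have "m dvd F $ i - hompoly e ?w (lin x) (vars $ 3)"
    using sub_dvd_diff[of m vars ?s "F $ i"] dv unfolding w(2) sub_vars by blast
  then obtain q where q: "F $ i - hompoly e ?w (lin x) (vars $ 3) = m * q" by (elim dvdE)
  have "hompoly e ?w (lin x) (vars $ 3) = F $ i - q * m" unfolding mult.commute[of q] q[symmetric] by simp
  also have "\<dots> *s \<rho>1 = dotp (axis i 1) F *s \<rho>1 - q *s (m *s \<rho>1)"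
    by (simp add: dotp_axis vector_sub_rdistrib)
  also have "\<dots> \<in> koszul F"
    by (intro koszul_diff gradient_ideal_kills koszul_scale m \<rho>1)
  finally obtain h2 a' b' where h2: "h2 *s \<rho>1 \<notin> koszul F" "a' \<noteq> 0 \<or> b' \<noteq> 0"
      "(const a' * lin x + const b' * vars $ 3) *s (h2 *s \<rho>1) \<in> koszul F"
    using binary_form_linear_factor[OF i w(1)] \<rho>1 by blast
  define \<rho>2 where "\<rho>2 = h2 *s \<rho>1"
  define c2 where "c2 = a' *s x + b' *s axis 3 1"
  have 2: "lin c2 *s \<rho>2 \<in> koszul F" using h2(3) by (simp add: c2_def lin_simps lin_axis \<rho>2_def del: vars_nth)
  have 1: "lin c1 *s \<rho>2 \<in> koszul F"
    using koszul_scale[OF m, of h2] by (simp add: \<rho>2_def m_def mult.commute)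
  define p where "p = cr c1 c2"
  have p0: "p \<noteq> 0"
    using ab(2) h2(2) by (auto simp: p_def c1_def c2_def x_def vec3_eq_iff vector_3 axis_def split: if_splits)
  have L: "lin c *s \<rho>2 \<in> koszul F" if cp: "dotp c p = 0" for c
  proof -
    obtain s t where "c = s *s c1 + t *s c2"
      using orthogonal_cross_span p0 cp unfolding p_def by blast
    then have "lin c *s \<rho>2 = const s *s (lin c1 *s \<rho>2) + const t *s (lin c2 *s \<rho>2)"
      by (simp add: lin_simps vector_sadd_rdistrib)
    then show ?thesis using koszul_add[OF koszul_scale[OF 1] koszul_scale[OF 2]] by simp
  qed
  show thesis
  proof (rule that[of p "h2 * h1"])
    show "ev (F $ i) p = 0" for i
    proof (rule ccontr)
      assume n: "ev (F $ i) p \<noteq> 0"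
      have "dotp \<rho>2 F = 0" using \<rho>1 by (simp add: \<rho>2_def dotp_simps)
      then have "F $ i *s \<rho>2 \<in> koszul F" using gradient_ideal_kills[of \<rho>2 F "axis i 1"] by (simp add: dotp_axis)
      from koszul_saturated[OF F(1) p0 L F(2) n this] have "\<rho>2 \<in> koszul F" by simp
      then show False using h2(1) by (simp add: \<rho>2_def)
    qed
  qed (use p0 h2(1) L in \<open>simp_all add: \<rho>2_def \<rho>1_def\<close>)
qed



section \<open>Nodes\<close>

definition chart_poly :: "complex^3 \<Rightarrow> complex^3 \<Rightarrow> complex^3 \<Rightarrow> tpoly \<Rightarrow> complex poly poly" where
  "chart_poly p u v = sub (\<lambda>c. [:[:c:]:]) (\<chi> i. [:[:p $ i, u $ i:], [:v $ i:]:])"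

lemma is_hom_pCons2: "is_hom (\<lambda>c :: complex. [:[:c:]:])"
  by (rule is_homI) (simp_all add: one_pCons)

lemma is_hom_chart_poly: "is_hom (chart_poly p u v)"
  unfolding chart_poly_def by (intro is_hom_sub is_hom_pCons2)

lemma chart_poly_const [simp]: "chart_poly p u v (const c) = [:[:c:]:]"
  and chart_poly_var [simp]: "chart_poly p u v (vars $ i) = [:[:p $ i, u $ i:], [:v $ i:]:]"
  by (simp_all add: chart_poly_def sub_const sub_var is_hom_pCons2 del: vars_nth)

lemmas chart_poly_simps = is_hom_one[OF is_hom_chart_poly] is_hom_add[OF is_hom_chart_poly]
  is_hom_mult[OF is_hom_chart_poly]

lemma poly_chart_poly: "poly (poly (chart_poly p u v f) [:t:]) s = ev f (p + s *s u + t *s v)"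
proof (rule is_hom_eqI[where h = "\<lambda>f. poly (poly (chart_poly p u v f) [:t:]) s"])
  show "is_hom (\<lambda>f. poly (poly (chart_poly p u v f) [:t:]) s)"
    by (rule is_homI) (simp_all add: chart_poly_simps)
qed (simp_all add: is_hom_ev algebra_simps del: vars_nth)

lemma pderiv_chart_poly:
  "map_poly pderiv (chart_poly p u v f) = chart_poly p u v (D u f)"
  "pderiv (chart_poly p u v f) = chart_poly p u v (D v f)"
proof -
  have der: "is_der (map_poly pderiv :: complex poly poly \<Rightarrow> _)"
    by (intro is_der_map_poly is_der_pderiv)
  show "map_poly pderiv (chart_poly p u v f) = chart_poly p u v (D u f)"
    by (induction f rule: tpoly_induct)
       (simp_all add: D_simps chart_poly_simps is_der_add[OF der] is_der_mult[OF der] map_poly_pCons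
          pderiv_pCons is_hom_zero[OF is_hom_chart_poly] del: vars_nth)
  show "pderiv (chart_poly p u v f) = chart_poly p u v (D v f)"
    by (induction f rule: tpoly_induct)
       (simp_all add: D_simps chart_poly_simps pderiv_add pderiv_mult
          pderiv_pCons is_hom_zero[OF is_hom_chart_poly] algebra_simps del: vars_nth)
qed

lemma local_equation_unique:
  assumes "local_equation f p u v g"
  shows "g = chart_poly p u v f"
proof -
  have "poly (poly (g - chart_poly p u v f) [:t:]) s = 0" for s t
    using assms by (simp add: local_equation_def poly_chart_poly)
  then have "poly (g - chart_poly p u v f) [:t:] = 0" for t
    by (intro poly_zero_if_roots[where c = "\<lambda>x. x"]) simp_all
  then have "g - chart_poly p u v f = 0"
    by (intro poly_zero_if_roots[where c = "\<lambda>x. [:x:]"]) (simp_all add: inj_def)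
  then show ?thesis by simp
qed

lemma coeff_chart_poly_0: "coeff (coeff (chart_poly p u v f) 0) 0 = ev f p"
proof -
  have "poly (poly (chart_poly p u v f) [:0:]) 0 = ev f (p + 0 *s u + 0 *s v)"
    by (rule poly_chart_poly)
  then show ?thesis by (simp add: poly_0_coeff_0)
qed

lemma node_hessian:
  assumes "node_at f p"
  obtains u v where "dotp p (cr u v) \<noteq> 0"
    "ev (D u (D u f)) p * ev (D v (D v f)) p - ev (D u (D v f)) p ^ 2 \<noteq> 0"
    "ev f p = 0" "ev (D u f) p = 0" "ev (D v f) p = 0"
proof -
  obtain u v g a b a' b' where c0: "coeff (coeff g 0) 0 = 0" "coeff (coeff g 0) 1 = 0" "coeff (coeff g 1) 0 = 0"
    and g: "local_equation f p u v g" and ab: "a * b' - a' * b \<noteq> 0"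
    and c: "coeff (coeff g 0) 2 = a * a'" "coeff (coeff g 1) 1 = a * b' + a' * b" "coeff (coeff g 2) 0 = b * b'"
    using assms unfolding node_at_def by blast
  have g': "g = chart_poly p u v f" using local_equation_unique[OF g] .
  have D2: "chart_poly p u v (D u (D u f)) = map_poly pderiv (map_poly pderiv g)"
    "chart_poly p u v (D u (D v f)) = map_poly pderiv (pderiv g)"
    "chart_poly p u v (D v (D v f)) = pderiv (pderiv g)"
    by (simp_all only: pderiv_chart_poly g')
  have C: "coeff (coeff (map_poly pderiv (map_poly pderiv g)) 0) 0 = 2 * coeff (coeff g 0) (Suc (Suc 0))"
    "coeff (coeff (map_poly pderiv (pderiv g)) 0) 0 = coeff (coeff g 1) 1"
    by (simp_all add: coeff_map_poly coeff_pderiv)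
  have "coeff (pderiv (pderiv g)) 0 = coeff g (Suc (Suc 0)) + coeff g (Suc (Suc 0))"
    by (simp add: coeff_pderiv)
  then have C3: "coeff (coeff (pderiv (pderiv g)) 0) 0 = 2 * coeff (coeff g (Suc (Suc 0))) 0"
    by (simp only: coeff_add mult_2)
  note c' = c[unfolded numeral_2_eq_2]
  have uu: "ev (D u (D u f)) p = 2 * (a * a')"
    using coeff_chart_poly_0[of p u v "D u (D u f)"] unfolding D2 C c' by (rule sym)
  have uv: "ev (D u (D v f)) p = a * b' + a' * b"
    using coeff_chart_poly_0[of p u v "D u (D v f)"] unfolding D2 C c' by (rule sym)
  have vv: "ev (D v (D v f)) p = 2 * (b * b')"
    using coeff_chart_poly_0[of p u v "D v (D v f)"] unfolding D2 C3 c' by (rule sym)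
  have "ev (D u (D u f)) p * ev (D v (D v f)) p - ev (D u (D v f)) p ^ 2 = - ((a * b' - a' * b) ^ 2)"
    unfolding uu uv vv by (simp add: power2_eq_square algebra_simps)
  moreover have "dotp p (cr u v) \<noteq> 0"
    using g by (simp add: local_equation_def det_3 vector_3 dotp_def algebra_simps)
  moreover have "- ((a * b' - a' * b) ^ 2) \<noteq> 0" using ab by simp
  moreover have "ev f p = 0"
    using coeff_chart_poly_0[of p u v f] c0(1) by (simp flip: g')
  moreover have "ev (D u f) p = 0"
    using coeff_chart_poly_0[of p u v "D u f"] c0(2) by (simp add: coeff_map_poly coeff_pderiv flip: pderiv_chart_poly(1) g')
  moreover have "ev (D v f) p = 0"
    using coeff_chart_poly_0[of p u v "D v f"] c0(3) by (simp add: coeff_pderiv flip: pderiv_chart_poly(2) g')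
  ultimately show thesis using that by metis
qed

lemma ideal_of_point_generators:
  assumes G: "homogeneous k G" "ev G p = 0" "k \<ge> 1"
    and ab: "\<And>c. dotp c p = 0 \<Longrightarrow> \<exists>s t. c = s *s a + t *s b" and p: "p \<noteq> 0"
  obtains A B where "G = A * lin a + B * lin b" "homogeneous (k - 1) A" "homogeneous (k - 1) B"
proof -
  obtain t where t: "dotp t p = 1" using dotp_normalized[OF p] .
  define I where "I = {A * lin a + B * lin b | A B. True}"
  have "G - const (ev G p) * lin t ^ k \<in> I"
  proof (rule form_mod_point_ideal[OF _ _ _ t G(1)])
    fix x y assume "x \<in> I" "y \<in> I"
    then obtain A B A' B' where "x = A * lin a + B * lin b" "y = A' * lin a + B' * lin b"
      unfolding I_def by blast
    then have "x + y = (A + A') * lin a + (B + B') * lin b" by (simp add: algebra_simps)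
    then show "x + y \<in> I" unfolding I_def by blast
  next
    fix h x assume "x \<in> I"
    then obtain A B where "x = A * lin a + B * lin b" unfolding I_def by blast
    then have "h * x = (h * A) * lin a + (h * B) * lin b" by (simp add: algebra_simps)
    then show "h * x \<in> I" unfolding I_def by blast
  next
    fix c assume "dotp c p = 0"
    then obtain s t where "c = s *s a + t *s b" using ab by blast
    then have "lin c = const s * lin a + const t * lin b" by (simp add: lin_simps)
    then show "lin c \<in> I" unfolding I_def by blast
  qed
  then obtain A B where AB: "G = A * lin a + B * lin b" using G(2) by (auto simp: I_def)
  have "G = homcomp k G" using G(1) by (simp add: homogeneous_iff_homcomp)
  also have "\<dots> = homcomp (k - 1) A * lin a + homcomp (k - 1) B * lin b"
    using G(3) unfolding AB homcomp_add homcomp_mult[OF homogeneous_lin] by simp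
  finally show thesis using that homogeneous_homcomp by blast
qed

lemma D_lin: "D w (lin c) = const (dotp c w)"
  by (simp add: lin_def dotp_def D_simps const_add const_mult algebra_simps del: vars_nth)

lemma gradient_ideal_at_node:
  assumes f: "homogeneous d f" "d \<ge> 2" and s: "singular_at f p" and n: "node_at f p"
  obtains s k where "homogeneous k s" "ev s p \<noteq> 0"
    "\<And>c. dotp c p = 0 \<Longrightarrow> \<exists>a. s * lin c = dotp a (grad f)"
proof -
  obtain u v where uv: "dotp p (cr u v) \<noteq> 0"
    and H: "ev (D u (D u f)) p * ev (D v (D v f)) p - ev (D u (D v f)) p ^ 2 \<noteq> 0"
    using node_hessian[OF n] by metis
  define \<Delta> where "\<Delta> = dotp p (cr u v)"
  define a where "a = inverse \<Delta> *s cr v p"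
  define b where "b = inverse \<Delta> *s cr p u"
  have p: "p \<noteq> 0" using s by (simp add: singular_at_def)
  have \<Delta>: "dotp (cr v p) u = \<Delta>" "dotp (cr p u) v = \<Delta>" "\<Delta> \<noteq> 0"
    using uv by (simp_all add: \<Delta>_def dotp_def algebra_simps)
  have d: "dotp a p = 0" "dotp b p = 0" "dotp a u = 1" "dotp b v = 1" "dotp a v = 0" "dotp b u = 0"
    using \<Delta> by (simp_all add: a_def b_def dotp_simps dotp_cr)
  have span: "\<exists>s t. c = s *s a + t *s b" if "dotp c p = 0" for c
  proof -
    have "cr (cr v p) (cr p u) = \<Delta> *s p" by (simp add: vec3_eq_iff \<Delta>_def dotp_def algebra_simps)
    then have "cr a b = (inverse \<Delta> * inverse \<Delta> * \<Delta>) *s p" by (simp add: a_def b_def cr_simps)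
    then have ab: "cr a b = inverse \<Delta> *s p" using \<Delta>(3) by simp
    have "cr a b \<noteq> 0" using p \<Delta>(3) unfolding ab by simp
    moreover have "dotp c (cr a b) = 0" using that unfolding ab by (simp add: dotp_simps)
    ultimately show ?thesis by (meson orthogonal_cross_span)
  qed
  have ev0: "ev (D w f) p = 0" for w
    using s by (simp add: D_def dotp_def singular_at_def grad_nth)
  have d1: "d - 1 \<ge> 1" using f(2) by simp
  obtain A B where A: "D u f = A * lin a + B * lin b" "homogeneous (d - 1 - 1) A" "homogeneous (d - 1 - 1) B"
    using ideal_of_point_generators[OF homogeneous_D[OF f(1)] ev0 d1 span p] .
  obtain A' B' where A': "D v f = A' * lin a + B' * lin b" "homogeneous (d - 1 - 1) A'" "homogeneous (d - 1 - 1) B'"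
    using ideal_of_point_generators[OF homogeneous_D[OF f(1)] ev0 d1 span p] .
  have e: "ev (D u (D u f)) p = ev A p" "ev (D v (D u f)) p = ev B p"
      "ev (D u (D v f)) p = ev A' p" "ev (D v (D v f)) p = ev B' p"
    unfolding A(1) A'(1) by (simp_all add: D_simps D_lin d)
  show thesis
  proof (rule that)
    show "homogeneous ((d - 1 - 1) + (d - 1 - 1)) (A * B' - B * A')"
      by (intro homogeneous_diff homogeneous_mult A A')
    have "ev (D v (D u f)) p = ev (D u (D v f)) p" by (simp only: D_commute)
    then show "ev (A * B' - B * A') p \<noteq> 0" using H by (simp add: e power2_eq_square)
    fix c assume "dotp c p = 0"
    then obtain s t where "c = s *s a + t *s b" using span by blast
    then have "(A * B' - B * A') * lin c
        = const s * (B' * D u f - B * D v f) + const t * (A * D v f - A' * D u f)"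
      unfolding A(1) A'(1) by (simp add: lin_simps algebra_simps)
    also have "\<dots> = dotp (const s *s (B' *s constv u - B *s constv v)
        + const t *s (A *s constv v - A' *s constv u)) (grad f)"
      by (simp add: D_def dotp_simps algebra_simps)
    finally show "\<exists>a. (A * B' - B * A') * lin c = dotp a (grad f)" by blast
  qed
qed

section \<open>Syzygies of low degree are Koszul\<close>

definition hom_vec :: "nat \<Rightarrow> tpoly^3 \<Rightarrow> bool" where
  "hom_vec m \<rho> \<longleftrightarrow> (\<forall>i. homogeneous m (\<rho> $ i))"

lemma hom_vec_scale: "homogeneous k h \<Longrightarrow> hom_vec m \<rho> \<Longrightarrow> hom_vec (k + m) (h *s \<rho>)"
  by (simp add: hom_vec_def homogeneous_mult)

lemma hom_vec_add: "hom_vec m \<rho> \<Longrightarrow> hom_vec m \<sigma> \<Longrightarrow> hom_vec m (\<rho> + \<sigma>)"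
  and hom_vec_diff: "hom_vec m \<rho> \<Longrightarrow> hom_vec m \<sigma> \<Longrightarrow> hom_vec m (\<rho> - \<sigma>)"
  by (simp_all add: hom_vec_def homogeneous_add homogeneous_diff)

lemma hom_vec_cr:
  assumes "hom_vec m \<rho>" "hom_vec k \<sigma>"
  shows "hom_vec (m + k) (cr \<rho> \<sigma>)"
  using assms unfolding hom_vec_def forall_3 cr_nth
  by (auto intro!: homogeneous_diff homogeneous_mult)

lemma hom_vec_grad: "homogeneous d f \<Longrightarrow> hom_vec (d - 1) (grad f)"
  unfolding hom_vec_def by (intro allI homogeneous_grad)

lemma hom_vec_0_const:
  assumes "hom_vec 0 \<rho>"
  obtains w where "\<rho> = constv w"
proof -
  have "\<forall>i. \<exists>c. \<rho> $ i = const c" using assms by (simp add: hom_vec_def homogeneous_0_is_const)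
  then obtain w where "\<And>i. \<rho> $ i = const (w i)" by metis
  then show thesis by (intro that[of "\<chi> i. w i"]) (simp add: vec_eq_iff)
qed

lemma hom_vec_koszul:
  assumes F: "hom_vec e F" and \<rho>: "hom_vec m \<rho>" "\<rho> \<in> koszul F"
  obtains "m < e" "\<rho> = 0" | \<alpha> where "m \<ge> e" "hom_vec (m - e) \<alpha>" "\<rho> = cr \<alpha> F"
proof -
  obtain \<beta> where \<beta>: "\<rho> = cr \<beta> F" using \<rho>(2) by (auto simp: koszul_def)
  have F': "homogeneous e (F $ i)" for i using F by (simp add: hom_vec_def)
  have "\<rho> = (\<chi> i. homcomp m (\<rho> $ i))" using \<rho>(1) by (simp add: vec_eq_iff hom_vec_def homogeneous_iff_homcomp)
  also have "\<dots> = (if m < e then 0 else cr (\<chi> i. homcomp (m - e) (\<beta> $ i)) F)"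
  proof -
    have "homcomp m (x - y) = homcomp m x - homcomp m y" for x y
      using homcomp_add[of m "x - y" y] by simp
    then show ?thesis by (simp add: \<beta> vec3_eq_iff homcomp_mult[OF F'])
  qed
  finally show thesis
    using that(1) that(2)[of "\<chi> i. homcomp (m - e) (\<beta> $ i)"]
    by (cases "m < e") (auto simp: hom_vec_def homogeneous_homcomp)
qed

lemma hom_vec_multiple:
  assumes F: "hom_vec e F" "F \<noteq> 0" and \<rho>: "hom_vec m (h *s F)"
  shows "h *s F = 0 \<and> m < e \<or> homogeneous (m - e) h \<and> m \<ge> e \<or> h = 0"
proof (cases "h = 0")
  case False
  obtain i where i: "F $ i \<noteq> 0" using F(2) by (auto simp: vec_eq_iff)
  have hi: "homogeneous e (F $ i)" "homogeneous m (h * F $ i)" using F \<rho> by (auto simp: hom_vec_def)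
  obtain k where k: "homogeneous k h" using homogeneous_factor[OF hi(2)] False i by auto
  have "k + e = m" using homogeneous_unique[OF homogeneous_mult[OF k hi(1)] hi(2)] False i by simp
  then show ?thesis using k by auto
qed simp

lemma two_orthogonal_vectors:
  assumes "p \<noteq> (0 :: complex^3)"
  obtains a b where "cr a b \<noteq> 0" "dotp a p = 0" "dotp b p = 0"
proof -
  have c: "cr (cr p x) (cr p y) = dotp p (cr x y) *s p" for x y
    by (simp add: vec3_eq_iff dotp_def algebra_simps)
  have d: "dotp (cr p x) p = 0" for x by (simp add: dotp_def algebra_simps)
  have "\<exists>x y. dotp p (cr x y) \<noteq> 0"
  proof (rule ccontr)
    assume "\<not> ?thesis"
    then have z: "dotp p (cr x y) = 0" for x y by blast
    have "p $ 1 = 0" using z[of "axis 2 1" "axis 3 1"] by (simp add: dotp_def axis_def)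
    moreover have "p $ 2 = 0" using z[of "axis 3 1" "axis 1 1"] by (simp add: dotp_def axis_def)
    moreover have "p $ 3 = 0" using z[of "axis 1 1" "axis 2 1"] by (simp add: dotp_def axis_def)
    ultimately show False using assms by (simp add: vec3_eq_iff)
  qed
  then obtain x y where "dotp p (cr x y) \<noteq> 0" by blast
  then show thesis using that[of "cr p x" "cr p y"] c d assms by simp
qed

text \<open>The link of a reduced point in a complete intersection of two curves of degree \<open>e\<close>
  starts in degree \<open>2 e - 2\<close>.\<close>

lemma koszul_of_point_multiples:
  assumes F: "coprime3 F" "hom_vec e F" and \<rho>: "hom_vec m \<rho>" "m + 3 \<le> 2 * e"
    and p: "p \<noteq> 0" "\<And>c. dotp c p = 0 \<Longrightarrow> lin c *s \<rho> \<in> koszul F"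
  shows "\<rho> \<in> koszul F"
proof -
  obtain a b where ab: "cr a b \<noteq> 0" "dotp a p = 0" "dotp b p = 0" using two_orthogonal_vectors[OF p(1)] .
  have "a \<noteq> 0" using ab(1) by (auto simp: cr_simps)
  then have a0: "lin a \<noteq> 0" by (simp add: lin_eq_0_iff)
  have hl: "hom_vec (1 + m) (lin c *s \<rho>)" for c by (intro hom_vec_scale homogeneous_lin \<rho>)
  show ?thesis
  proof (cases "1 + m < e")
    case True
    have "lin a *s \<rho> = 0" by (rule hom_vec_koszul[OF F(2) hl p(2)[OF ab(2)]]) (use True in auto)
    then have "\<rho> = 0" using a0 by (simp add: vec_eq_iff)
    then show ?thesis by (simp add: koszul_0)
  next
    case False
    obtain \<alpha> where \<alpha>: "hom_vec (1 + m - e) \<alpha>" "lin a *s \<rho> = cr \<alpha> F"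
      using hom_vec_koszul[OF F(2) hl p(2)[OF ab(2)]] False by metis
    obtain \<beta> where \<beta>: "hom_vec (1 + m - e) \<beta>" "lin b *s \<rho> = cr \<beta> F"
      using hom_vec_koszul[OF F(2) hl p(2)[OF ab(3)]] False by metis
    define \<xi> where "\<xi> = lin b *s \<alpha> - lin a *s \<beta>"
    have "cr \<xi> F = 0" unfolding \<xi>_def
      by (simp add: cr_simps mult.commute flip: \<alpha>(2) \<beta>(2))
    then obtain h where h: "\<xi> = h *s F" using parallel_coprime3[OF F(1)] by blast
    have "hom_vec (1 + (1 + m - e)) \<xi>" unfolding \<xi>_def
      by (intro hom_vec_diff hom_vec_scale homogeneous_lin \<alpha> \<beta>)
    then have "\<xi> = 0"
      using hom_vec_multiple[OF F(2) coprime3_nonzero[OF F(1)], of "1 + (1 + m - e)" h] \<rho>(2) False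
      unfolding h by auto
    then have "lin b * \<alpha> $ i = lin a * \<beta> $ i" for i by (simp add: \<xi>_def vec_eq_iff)
    then have "lin a dvd \<alpha> $ i" for i using lin_dvd_multD[OF ab(1)] by (metis dvd_triv_left)
    then have "\<forall>i. \<exists>c. \<alpha> $ i = lin a * c" by (meson dvdE)
    then obtain c where "\<And>i. \<alpha> $ i = lin a * c i" by metis
    then have c: "\<alpha> = lin a *s (\<chi> i. c i)" by (simp add: vec_eq_iff)
    have "lin a *s (\<rho> - cr (\<chi> i. c i) F) = 0"
      using \<alpha>(2) unfolding c by (simp add: cr_simps vec_eq_iff algebra_simps)
    then have "\<rho> = cr (\<chi> i. c i) F" using a0 by (simp add: vec_eq_iff)
    then show ?thesis by (simp add: koszul_def)
  qed
qed

lemma syzygies_koszul_of_points: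
  assumes f: "reduced_curve d f" "nodal f" "d \<ge> 2"
    and "dotp \<rho> (grad f) = 0" "hom_vec m \<rho>" "m + length ps + 4 \<le> 2 * d" "0 \<notin> set ps"
    and "\<And>p. singular_at f p \<Longrightarrow> (\<forall>q\<in>set ps. p \<notin> proj_point q) \<Longrightarrow>
      \<exists>s k. homogeneous k s \<and> ev s p \<noteq> 0 \<and> s *s \<rho> \<in> koszul (grad f)"
  shows "\<rho> \<in> koszul (grad f)"
  using assms(4-)
proof (induction ps arbitrary: \<rho> m)
  case Nil
  have h: "homogeneous d f" using f(1) by (simp add: reduced_curve_def)
  show ?case
  proof (rule ccontr)
    assume "\<rho> \<notin> koszul (grad f)"
    then obtain h p where hp: "p \<noteq> 0" "\<And>i. ev (grad f $ i) p = 0" "h *s \<rho> \<notin> koszul (grad f)"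
        "\<And>c. dotp c p = 0 \<Longrightarrow> lin c *s (h *s \<rho>) \<in> koszul (grad f)"
      using syzygy_associated_point[OF coprime3_grad[OF f(1)] homogeneous_grad[OF h] Nil.prems(1)] by metis
    have "of_nat d * ev f p = 0"
      using arg_cong[OF euler[OF h], of "\<lambda>g. ev g p"] hp(2) by (simp add: dotp_def del: vars_nth)
    then have "singular_at f p" using hp(1,2) f(3) by (simp add: singular_at_def flip: grad_nth)
    then obtain s k where s: "homogeneous k s" "ev s p \<noteq> 0" "s *s \<rho> \<in> koszul (grad f)"
      using Nil.prems(5)[of p] unfolding list.set by blast
    have "s *s (h *s \<rho>) \<in> koszul (grad f)" using koszul_scale[OF s(3), of h] by (simp add: mult.commute)
    from koszul_saturated[OF coprime3_grad[OF f(1)] hp(1,4) s(1,2) this] hp(3) show False by simp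
  qed
next
  case (Cons q ps)
  have h: "homogeneous d f" using f(1) by (simp add: reduced_curve_def)
  have "lin c *s \<rho> \<in> koszul (grad f)" if c: "dotp c q = 0" for c
  proof (rule Cons.IH)
    show "dotp (lin c *s \<rho>) (grad f) = 0" using Cons.prems(1) by (simp add: dotp_simps)
    show "hom_vec (1 + m) (lin c *s \<rho>)" by (intro hom_vec_scale homogeneous_lin Cons.prems(2))
    show "1 + m + length ps + 4 \<le> 2 * d" "0 \<notin> set ps" using Cons.prems(3,4) by simp_all
    fix p assume p: "singular_at f p" "\<forall>q\<in>set ps. p \<notin> proj_point q"
    show "\<exists>s k. homogeneous k s \<and> ev s p \<noteq> 0 \<and> s *s (lin c *s \<rho>) \<in> koszul (grad f)"
    proof (cases "p \<in> proj_point q")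
      case True
      then have cp: "dotp c p = 0" using c by (auto simp: proj_point_def dotp_simps)
      have "node_at f p" using f(2) p(1) by (simp add: nodal_def)
      then obtain s k where s: "homogeneous k s" "ev s p \<noteq> 0" "\<exists>a. s * lin c = dotp a (grad f)"
        using gradient_ideal_at_node[OF h f(3) p(1)] cp by metis
      then obtain a where "s * lin c = dotp a (grad f)" by blast
      then have "s *s (lin c *s \<rho>) \<in> koszul (grad f)"
        using gradient_ideal_kills[OF Cons.prems(1), of a] by simp
      then show ?thesis using s by blast
    next
      case False
      then obtain s k where s: "homogeneous k s" "ev s p \<noteq> 0" "s *s \<rho> \<in> koszul (grad f)"
        using Cons.prems(5)[OF p(1)] p(2) unfolding list.set by blast
      have "s *s (lin c *s \<rho>) \<in> koszul (grad f)" using koszul_scale[OF s(3), of "lin c"] by (simp add: mult.commute)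
      then show ?thesis using s by blast
    qed
  qed
  moreover have "q \<noteq> 0" "m + 3 \<le> 2 * (d - 1)" using Cons.prems(3,4) by auto
  ultimately show ?case
    using koszul_of_point_multiples[OF coprime3_grad[OF f(1)] hom_vec_grad[OF h] Cons.prems(2)] by blast
qed

lemma nodal_low_degree_syzygies:
  assumes f: "reduced_curve d f" "nodal f" "d \<ge> 2" and n: "finite (nodes f)" "card (nodes f) + 3 \<le> d"
    and \<rho>: "dotp \<rho> (grad f) = 0" "hom_vec m \<rho>" "m \<le> d - 1"
  obtains w where "\<rho> = cr (constv w) (grad f)" "m < d - 1 \<longrightarrow> \<rho> = 0"
proof -
  define r where "r N = (SOME p. node_at f p \<and> N = proj_point p)" for N
  have r: "node_at f (r N) \<and> N = proj_point (r N)" if "N \<in> nodes f" for N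
    unfolding r_def by (rule someI_ex) (use that in \<open>auto simp: nodes_def\<close>)
  obtain Ns where Ns: "set Ns = nodes f" "length Ns = card (nodes f)"
    using finite_distinct_list[OF n(1)] distinct_card by metis
  have node0: "p \<noteq> 0" if "node_at f p" for p
    using node_hessian[OF that] by (metis dotp_simps(6))
  have "\<rho> \<in> koszul (grad f)"
  proof (rule syzygies_koszul_of_points[OF f \<rho>(1,2), of "map r Ns"])
    show "m + length (map r Ns) + 4 \<le> 2 * d" using n(2) \<rho>(3) f(3) by (simp add: Ns)
    show "0 \<notin> set (map r Ns)" using node0 r by (force simp: Ns)
    fix p assume p: "singular_at f p" "\<forall>q\<in>set (map r Ns). p \<notin> proj_point q"
    then have "proj_point p \<in> nodes f" using f(2) by (auto simp: nodes_def nodal_def)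
    then have "p \<notin> proj_point p" using p(2) r by (metis Ns(1) image_eqI set_map)
    moreover have "p \<in> proj_point p" unfolding proj_point_def by (force intro: exI[of _ 1])
    ultimately show "\<exists>s k. homogeneous k s \<and> ev s p \<noteq> 0 \<and> s *s \<rho> \<in> koszul (grad f)" by blast
  qed
  moreover have "hom_vec (d - 1) (grad f)" using f(1) hom_vec_grad unfolding reduced_curve_def by blast
  ultimately consider "m < d - 1" "\<rho> = 0" | \<alpha> where "m \<ge> d - 1" "hom_vec (m - (d - 1)) \<alpha>" "\<rho> = cr \<alpha> (grad f)"
    using hom_vec_koszul \<rho>(2) by blast
  then show thesis
  proof cases
    case 1
    then show ?thesis using that[of 0] by (simp add: constv_simps cr_simps)
  next
    case 2
    then show ?thesis using hom_vec_0_const[of \<alpha>] that \<rho>(3) by (metis diff_is_0_eq' not_le)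
  qed
qed



section \<open>Sections of twisted sheaves\<close>

definition Dset :: "tpoly \<Rightarrow> (complex^3) set" where "Dset F = {v. v \<noteq> 0 \<and> ev F v \<noteq> 0}"

lemma zariski_open_Dset: "homogeneous m F \<Longrightarrow> zariski_open (Dset F)"
  unfolding zariski_open_def Dset_def by (rule exI[of _ "{F}"]) auto

lemma zariski_open_Int:
  assumes "zariski_open V" "zariski_open W"
  shows "zariski_open (V \<inter> W)"
proof -
  obtain A where A: "\<forall>F\<in>A. \<exists>m. homogeneous m F" "V = {v. v \<noteq> 0 \<and> (\<exists>F\<in>A. ev F v \<noteq> 0)}"
    using assms(1) unfolding zariski_open_def by blast
  obtain B where B: "\<forall>F\<in>B. \<exists>m. homogeneous m F" "W = {v. v \<noteq> 0 \<and> (\<exists>F\<in>B. ev F v \<noteq> 0)}"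
    using assms(2) unfolding zariski_open_def by blast
  define C where "C = {F * G | F G. F \<in> A \<and> G \<in> B}"
  have "\<forall>F\<in>C. \<exists>m. homogeneous m F" using A(1) B(1) homogeneous_mult unfolding C_def by blast
  moreover have "V \<inter> W = {v. v \<noteq> 0 \<and> (\<exists>F\<in>C. ev F v \<noteq> 0)}"
    unfolding A(2) B(2) C_def by auto (metis ev_simps(2) mult_eq_0_iff)
  ultimately show ?thesis unfolding zariski_open_def by blast
qed

lemma zariski_open_basic:
  assumes "zariski_open V" "w \<in> V"
  obtains F where "F \<noteq> 0" "\<And>v. v \<noteq> 0 \<Longrightarrow> ev F v \<noteq> 0 \<Longrightarrow> v \<in> V"
proof -
  obtain A where A: "V = {v. v \<noteq> 0 \<and> (\<exists>F\<in>A. ev F v \<noteq> 0)}"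
    using assms(1) unfolding zariski_open_def by blast
  then obtain F where F: "F \<in> A" "ev F w \<noteq> 0" using assms(2) by blast
  show thesis by (rule that[of F]) (use F in \<open>auto simp: A\<close>)
qed

lemma twistE:
  assumes "s \<in> twist k W" "w \<in> W"
  obtains V G H m n where "zariski_open V" "w \<in> V" "V \<subseteq> W" "homogeneous m G" "homogeneous n H"
    "int m - int n = k" "\<And>v. v \<in> V \<Longrightarrow> ev H v \<noteq> 0" "\<And>v. v \<in> V \<Longrightarrow> s v = ev G v / ev H v"
proof -
  have "\<forall>w\<in>W. \<exists>V G H m n. zariski_open V \<and> w \<in> V \<and> V \<subseteq> W \<and>
            homogeneous m G \<and> homogeneous n H \<and> int m - int n = k \<and>
            (\<forall>v\<in>V. ev H v \<noteq> 0 \<and> s v = ev G v / ev H v)"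
    using assms(1) unfolding twist_def by simp
  from bspec[OF this assms(2)] show thesis using that by (elim exE conjE) auto
qed

lemma twistI:
  assumes "\<And>v. v \<notin> W \<Longrightarrow> s v = 0"
    and "\<And>w. w \<in> W \<Longrightarrow> \<exists>V G H m n. zariski_open V \<and> w \<in> V \<and> V \<subseteq> W \<and>
            homogeneous m G \<and> homogeneous n H \<and> int m - int n = k \<and>
            (\<forall>v\<in>V. ev H v \<noteq> 0 \<and> s v = ev G v / ev H v)"
  shows "s \<in> twist k W"
  unfolding twist_def
proof (intro CollectI conjI)
  show "\<forall>v. v \<notin> W \<longrightarrow> s v = 0" by (intro allI impI) (rule assms(1))
  show "\<forall>w\<in>W. \<exists>V G H m n. zariski_open V \<and> w \<in> V \<and> V \<subseteq> W \<and>
            homogeneous m G \<and> homogeneous n H \<and> int m - int n = k \<and>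
            (\<forall>v\<in>V. ev H v \<noteq> 0 \<and> s v = ev G v / ev H v)"
    by (intro ballI) (rule assms(2))
qed

lemma twist_outside: "s \<in> twist k W \<Longrightarrow> v \<notin> W \<Longrightarrow> s v = 0"
  unfolding twist_def by blast

lemma twist_quotient:
  assumes "zariski_open W" "homogeneous m G" "homogeneous n H" "int m - int n = k"
    and "\<And>v. v \<in> W \<Longrightarrow> ev H v \<noteq> 0" "\<And>v. v \<in> W \<Longrightarrow> s v = ev G v / ev H v"
    and "\<And>v. v \<notin> W \<Longrightarrow> s v = 0"
  shows "s \<in> twist k W"
proof (rule twistI)
  fix w assume "w \<in> W"
  then show "\<exists>V G H m n. zariski_open V \<and> w \<in> V \<and> V \<subseteq> W \<and>
            homogeneous m G \<and> homogeneous n H \<and> int m - int n = k \<and>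
            (\<forall>v\<in>V. ev H v \<noteq> 0 \<and> s v = ev G v / ev H v)"
    by - (rule exI[of _ W], rule exI[of _ G], rule exI[of _ H], rule exI[of _ m], rule exI[of _ n],
        simp add: assms)
qed (rule assms)

lemma twist_mult:
  assumes "r \<in> twist j W" "s \<in> twist k W"
  shows "(\<lambda>v. r v * s v) \<in> twist (j + k) W"
proof (rule twistI)
  fix w assume w: "w \<in> W"
  obtain V G H m n where 1: "zariski_open V" "w \<in> V" "V \<subseteq> W" "homogeneous m G" "homogeneous n H"
    "int m - int n = j" "\<And>v. v \<in> V \<Longrightarrow> ev H v \<noteq> 0" "\<And>v. v \<in> V \<Longrightarrow> r v = ev G v / ev H v"
    using twistE[OF assms(1) w] by metis
  obtain V' G' H' m' n' where 2: "zariski_open V'" "w \<in> V'" "V' \<subseteq> W" "homogeneous m' G'" "homogeneous n' H'"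
    "int m' - int n' = k" "\<And>v. v \<in> V' \<Longrightarrow> ev H' v \<noteq> 0" "\<And>v. v \<in> V' \<Longrightarrow> s v = ev G' v / ev H' v"
    using twistE[OF assms(2) w] by metis
  show "\<exists>V G H m n. zariski_open V \<and> w \<in> V \<and> V \<subseteq> W \<and>
            homogeneous m G \<and> homogeneous n H \<and> int m - int n = j + k \<and>
            (\<forall>v\<in>V. ev H v \<noteq> 0 \<and> r v * s v = ev G v / ev H v)"
    by (rule exI[of _ "V \<inter> V'"], rule exI[of _ "G * G'"], rule exI[of _ "H * H'"],
        rule exI[of _ "m + m'"], rule exI[of _ "n + n'"])
       (use 1 2 in \<open>auto simp: zariski_open_Int homogeneous_mult\<close>)
qed (simp add: twist_outside[OF assms(1)] twist_outside[OF assms(2)])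

lemma twist_add:
  assumes "r \<in> twist k W" "s \<in> twist k W"
  shows "(\<lambda>v. r v + s v) \<in> twist k W"
proof (rule twistI)
  fix w assume w: "w \<in> W"
  obtain V G H m n where 1: "zariski_open V" "w \<in> V" "V \<subseteq> W" "homogeneous m G" "homogeneous n H"
    "int m - int n = k" "\<And>v. v \<in> V \<Longrightarrow> ev H v \<noteq> 0" "\<And>v. v \<in> V \<Longrightarrow> r v = ev G v / ev H v"
    using twistE[OF assms(1) w] by metis
  obtain V' G' H' m' n' where 2: "zariski_open V'" "w \<in> V'" "V' \<subseteq> W" "homogeneous m' G'" "homogeneous n' H'"
    "int m' - int n' = k" "\<And>v. v \<in> V' \<Longrightarrow> ev H' v \<noteq> 0" "\<And>v. v \<in> V' \<Longrightarrow> s v = ev G' v / ev H' v"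
    using twistE[OF assms(2) w] by metis
  have mn: "n + m' = m + n'" using 1(6) 2(6) by linarith
  have h: "homogeneous (m + n') (G * H' + H * G')"
    using homogeneous_mult[OF 1(4) 2(5)] homogeneous_mult[OF 1(5) 2(4)] unfolding mn by (rule homogeneous_add)
  have "int (m + n') - int (n + n') = k" using 1(6) by simp
  moreover have "ev (H * H') v \<noteq> 0 \<and> r v + s v = ev (G * H' + H * G') v / ev (H * H') v" if "v \<in> V \<inter> V'" for v
  proof -
    have v: "ev H v \<noteq> 0" "ev H' v \<noteq> 0" "r v = ev G v / ev H v" "s v = ev G' v / ev H' v"
      using 1(7,8) 2(7,8) that by blast+
    show ?thesis using v(1,2) unfolding v(3,4) by (simp add: add_frac_eq mult.commute)
  qed
  ultimately show "\<exists>V G H m n. zariski_open V \<and> w \<in> V \<and> V \<subseteq> W \<and>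
            homogeneous m G \<and> homogeneous n H \<and> int m - int n = k \<and>
            (\<forall>v\<in>V. ev H v \<noteq> 0 \<and> r v + s v = ev G v / ev H v)"
    using zariski_open_Int[OF 1(1) 2(1)] 1(2,3) 2(2) h homogeneous_mult[OF 1(5) 2(5)]
    by - (rule exI[of _ "V \<inter> V'"], rule exI[of _ "G * H' + H * G'"], rule exI[of _ "H * H'"],
        rule exI[of _ "m + n'"], rule exI[of _ "n + n'"], blast)
qed (simp add: twist_outside[OF assms(1)] twist_outside[OF assms(2)])

lemma twist_restrict:
  assumes "s \<in> twist k W" "zariski_open V" "V \<subseteq> W"
  shows "(\<lambda>v. if v \<in> V then s v else 0) \<in> twist k V"
proof (rule twistI)
  fix w assume w: "w \<in> V"
  then have "w \<in> W" using assms(3) by blast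
  obtain U G H m n where 1: "zariski_open U" "w \<in> U" "U \<subseteq> W" "homogeneous m G" "homogeneous n H"
    "int m - int n = k" "\<And>v. v \<in> U \<Longrightarrow> ev H v \<noteq> 0" "\<And>v. v \<in> U \<Longrightarrow> s v = ev G v / ev H v"
    using twistE[OF assms(1) \<open>w \<in> W\<close>] by metis
  show "\<exists>U G H m n. zariski_open U \<and> w \<in> U \<and> U \<subseteq> V \<and>
            homogeneous m G \<and> homogeneous n H \<and> int m - int n = k \<and>
            (\<forall>v\<in>U. ev H v \<noteq> 0 \<and> (if v \<in> V then s v else 0) = ev G v / ev H v)"
    by (rule exI[of _ "U \<inter> V"], rule exI[of _ G], rule exI[of _ H], rule exI[of _ m], rule exI[of _ n])
       (use 1 w assms(2) in \<open>auto simp: zariski_open_Int\<close>)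
qed simp

lemma form_without_zeros_const:
  assumes "homogeneous N Q" "\<And>v. v \<noteq> 0 \<Longrightarrow> ev Q v \<noteq> 0"
  obtains c where "Q = const c"
proof -
  define u where "u = (axis 1 1 :: complex^3)"
  define v where "v = (axis 2 1 :: complex^3)"
  let ?w = "along_line u v Q"
  have "sub const (0 *s constv u + 1 *s constv v) Q = hompoly N ?w 0 1"
    using homogeneous_along_line[OF assms(1)] by blast
  also have "\<dots> = const (coeff ?w N)"
  proof -
    have "hompoly N ?w 0 1 = (\<Sum>j\<le>N. if j = N then const (coeff ?w N) else 0)"
      unfolding hompoly_def by (rule sum.cong) (auto simp: power_0_left)
    then show ?thesis by simp
  qed
  finally have "ev (sub const (0 *s constv u + 1 *s constv v) Q) 0 = coeff ?w N" by simp
  moreover have "(\<chi> i. ev ((0 *s constv u + 1 *s constv v) $ i) 0) = v" by (simp add: vec_eq_iff)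
  ultimately have c: "ev Q v = coeff ?w N" by (simp only: ev_sub)
  have "v \<noteq> 0" by (simp add: v_def)
  then have "coeff ?w N \<noteq> 0" using assms(2) c by metis
  have "N = 0"
  proof (rule ccontr)
    assume "N \<noteq> 0"
    then have "degree ?w \<noteq> 0" using \<open>coeff ?w N \<noteq> 0\<close> le_degree by fastforce
    then have "\<not> constant (poly ?w)" by (simp add: constant_degree)
    then obtain t where "poly ?w t = 0" using fundamental_theorem_of_algebra by blast
    then have "ev Q (u + t *s v) = 0" by (simp add: poly_along_line)
    moreover have "(u + t *s v) $ 1 \<noteq> 0" by (simp add: u_def v_def axis_def)
    then have "u + t *s v \<noteq> 0" by (metis zero_index)
    ultimately show False using assms(2) by blast
  qed
  then show thesis using that assms(1) homogeneous_0_is_const by blast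
qed

text \<open>Global sections of \<open>\<O>(m)\<close>: all local fractions have the same reduced form, whose
  denominator has no zeros.\<close>

lemma global_sections_twist:
  assumes s: "s \<in> twist (int m) {v. v \<noteq> 0}"
  obtains P where "homogeneous m P" "\<And>v. v \<noteq> 0 \<Longrightarrow> s v = ev P v"
proof -
  have ax: "axis 1 1 \<in> {v :: complex^3. v \<noteq> 0}" by simp
  obtain V0 G0 H0 m0 n0 where 0: "zariski_open V0" "axis 1 1 \<in> V0" "homogeneous m0 G0" "homogeneous n0 H0"
      "int m0 - int n0 = int m" "\<And>v. v \<in> V0 \<Longrightarrow> ev H0 v \<noteq> 0" "\<And>v. v \<in> V0 \<Longrightarrow> s v = ev G0 v / ev H0 v"
    using twistE[OF s ax] by metis
  have H0: "H0 \<noteq> 0" using 0(2,6) by force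
  then have "gcd G0 H0 \<noteq> 0" by simp
  then obtain P Q where PQ: "G0 = P * gcd G0 H0" "H0 = Q * gcd G0 H0" "coprime P Q"
    using gcd_coprime_exists by blast
  define a where "a = gcd G0 H0"
  have a0: "a \<noteq> 0" using H0 by (simp add: a_def)
  have E: "G0 = P * a" "H0 = Q * a" using PQ by (simp_all add: a_def)
  have key: "ev Q w \<noteq> 0 \<and> s w = ev P w / ev Q w" if "w \<noteq> 0" for w
  proof -
    have "w \<in> {v. v \<noteq> 0}" using that by simp
    obtain V G H m1 n1 where 1: "zariski_open V" "w \<in> V" "homogeneous m1 G" "homogeneous n1 H"
        "\<And>v. v \<in> V \<Longrightarrow> ev H v \<noteq> 0" "\<And>v. v \<in> V \<Longrightarrow> s v = ev G v / ev H v"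
      using twistE[OF s \<open>w \<in> {v. v \<noteq> 0}\<close>] by metis
    obtain F0 where F0: "F0 \<noteq> 0" "\<And>v. v \<noteq> 0 \<Longrightarrow> ev F0 v \<noteq> 0 \<Longrightarrow> v \<in> V0"
      using zariski_open_basic[OF 0(1,2)] by blast
    obtain F1 where F1: "F1 \<noteq> 0" "\<And>v. v \<noteq> 0 \<Longrightarrow> ev F1 v \<noteq> 0 \<Longrightarrow> v \<in> V"
      using zariski_open_basic[OF 1(1,2)] by blast
    have "F0 * F1 * (G * H0 - G0 * H) = 0"
    proof (rule ev_eqI)
      fix v :: "complex^3" assume v: "v \<noteq> 0"
      show "ev (F0 * F1 * (G * H0 - G0 * H)) v = ev 0 v"
      proof (cases "ev F0 v = 0 \<or> ev F1 v = 0")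
        case False
        then have vV: "v \<in> V0" "v \<in> V" using F0(2) F1(2) v by blast+
        then have "ev G0 v / ev H0 v = ev G v / ev H v" using 0(7) 1(6) by metis
        then have "ev G v * ev H0 v = ev G0 v * ev H v"
          using 0(6)[OF vV(1)] 1(5)[OF vV(2)] by (simp add: field_simps)
        then show ?thesis by simp
      qed auto
    qed
    then have "G * H0 = G0 * H" using F0(1) F1(1) by simp
    then have "(G * Q) * a = (P * H) * a" unfolding E by (simp add: mult_ac)
    then have eq: "G * Q = P * H" using a0 by simp
    then have "Q dvd P * H" by (metis dvd_triv_right)
    then have "Q dvd H" using PQ(3) coprime_dvd_mult_right_iff coprime_commute by blast
    then obtain c where "H = Q * c" by (elim dvdE)
    then have Qw: "ev Q w \<noteq> 0" using 1(5)[OF 1(2)] by auto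
    have "ev G w * ev Q w = ev P w * ev H w" using arg_cong[OF eq, of "\<lambda>h. ev h w"] by simp
    then have "ev G w / ev H w = ev P w / ev Q w" using Qw 1(5)[OF 1(2)] by (simp add: field_simps)
    then show ?thesis using Qw 1(6)[OF 1(2)] by simp
  qed
  have h0: "homogeneous n0 (Q * a)" "Q * a \<noteq> 0" "homogeneous m0 (P * a)" using 0(3,4) H0 E by auto
  obtain N where N: "homogeneous N Q" using homogeneous_factor[OF h0(1,2)] .
  obtain c where c: "Q = const c" using form_without_zeros_const[OF N] key by metis
  have c0: "c \<noteq> 0" using key[of "axis 1 1"] c by simp
  have "homogeneous m P"
  proof (cases "P = 0")
    case False
    obtain k where k: "homogeneous k a" using homogeneous_factor[of n0 a Q] h0 by (metis mult.commute)
    obtain l where l: "homogeneous l P" using homogeneous_factor[OF h0(3)] a0 False by auto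
    have "0 + k = n0"
      using homogeneous_unique[OF homogeneous_mult[of 0 Q k a] h0(1,2)] k c by simp
    moreover have "l + k = m0"
      using homogeneous_unique[OF homogeneous_mult[OF l k] h0(3)] a0 False by simp
    ultimately have "l = m" using 0(5) by linarith
    then show ?thesis using l by simp
  qed simp
  then have "homogeneous m (const (inverse c) * P)" by (rule homogeneous_const_mult)
  moreover have "s v = ev (const (inverse c) * P) v" if "v \<noteq> 0" for v
    using key[OF that] c by (simp add: field_simps)
  ultimately show thesis by (rule that)
qed

section \<open>Logarithmic sheaves and graded syzygy modules\<close>

lemma log_sheafI:
  assumes "\<And>i. (\<lambda>v. s v $ i) \<in> twist 1 W"
    and "\<And>v. v \<in> W \<Longrightarrow> s v $ 1 * ev (grad f $ 1) v + s v $ 2 * ev (grad f $ 2) v + s v $ 3 * ev (grad f $ 3) v = 0"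
  shows "s \<in> log_sheaf f W"
  unfolding log_sheaf_def mem_Collect_eq grad_nth[symmetric] using assms by blast

lemma log_sheafD:
  assumes "s \<in> log_sheaf f W"
  shows "(\<lambda>v. s v $ i) \<in> twist 1 W"
    and "v \<in> W \<Longrightarrow> s v $ 1 * ev (grad f $ 1) v + s v $ 2 * ev (grad f $ 2) v + s v $ 3 * ev (grad f $ 3) v = 0"
  using assms unfolding log_sheaf_def mem_Collect_eq grad_nth[symmetric] by blast+

lemma log_sheaf_outside: "s \<in> log_sheaf f W \<Longrightarrow> v \<notin> W \<Longrightarrow> s v = 0"
  using twist_outside[OF log_sheafD(1)] by (simp add: vec_eq_iff)

lemma log_sheaf_add:
  assumes "s \<in> log_sheaf f W" "t \<in> log_sheaf f W"
  shows "(\<lambda>v. s v + t v) \<in> log_sheaf f W"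
proof (rule log_sheafI)
  show "(\<lambda>v. (s v + t v) $ i) \<in> twist 1 W" for i
    using twist_add[OF log_sheafD(1)[OF assms(1)] log_sheafD(1)[OF assms(2)]] by simp
  fix v assume "v \<in> W"
  from log_sheafD(2)[OF assms(1) this] log_sheafD(2)[OF assms(2) this]
  show "(s v + t v) $ 1 * ev (grad f $ 1) v + (s v + t v) $ 2 * ev (grad f $ 2) v
      + (s v + t v) $ 3 * ev (grad f $ 3) v = 0"
    by (simp add: algebra_simps) algebra
qed

lemma log_sheaf_scale:
  assumes "r \<in> twist 0 W" "s \<in> log_sheaf f W"
  shows "(\<lambda>v. r v *s s v) \<in> log_sheaf f W"
proof (rule log_sheafI)
  show "(\<lambda>v. (r v *s s v) $ i) \<in> twist 1 W" for i
    using twist_mult[OF assms(1) log_sheafD(1)[OF assms(2)]] by simp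
  fix v assume "v \<in> W"
  from log_sheafD(2)[OF assms(2) this]
  show "(r v *s s v) $ 1 * ev (grad f $ 1) v + (r v *s s v) $ 2 * ev (grad f $ 2) v
      + (r v *s s v) $ 3 * ev (grad f $ 3) v = 0"
    by simp algebra
qed

lemma log_sheaf_restrict:
  assumes "s \<in> log_sheaf f W" "zariski_open V" "V \<subseteq> W"
  shows "restrict_sec V s \<in> log_sheaf f V"
proof (rule log_sheafI)
  show "(\<lambda>v. restrict_sec V s v $ i) \<in> twist 1 V" for i
  proof -
    have "(\<lambda>v. restrict_sec V s v $ i) = (\<lambda>v. if v \<in> V then s v $ i else 0)"
      by (auto simp: restrict_sec_def)
    then show ?thesis using twist_restrict[OF log_sheafD(1)[OF assms(1)] assms(2,3)] by simp
  qed
  fix v assume "v \<in> V"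
  with log_sheafD(2)[OF assms(1), of v] assms(3)
  show "restrict_sec V s v $ 1 * ev (grad f $ 1) v + restrict_sec V s v $ 2 * ev (grad f $ 2) v
      + restrict_sec V s v $ 3 * ev (grad f $ 3) v = 0"
    by (auto simp: restrict_sec_def)
qed

definition sheaf_iso_via ::
    "((complex^3) set \<Rightarrow> (complex^3 \<Rightarrow> complex^3) set) \<Rightarrow>
     ((complex^3) set \<Rightarrow> (complex^3 \<Rightarrow> complex^3) set) \<Rightarrow>
     ((complex^3) set \<Rightarrow> (complex^3 \<Rightarrow> complex^3) \<Rightarrow> complex^3 \<Rightarrow> complex^3) \<Rightarrow> bool" where
  "sheaf_iso_via E F \<phi> \<longleftrightarrow> (\<forall>W. zariski_open W \<longrightarrow>
        bij_betw (\<phi> W) (E W) (F W) \<and>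
        (\<forall>s\<in>E W. \<forall>t\<in>E W. \<phi> W (\<lambda>v. s v + t v) = (\<lambda>v. \<phi> W s v + \<phi> W t v)) \<and>
        (\<forall>r\<in>twist 0 W. \<forall>s\<in>E W. \<phi> W (\<lambda>v. r v *s s v) = (\<lambda>v. r v *s \<phi> W s v)) \<and>
        (\<forall>V. zariski_open V \<and> V \<subseteq> W \<longrightarrow>
           (\<forall>s\<in>E W. \<phi> V (restrict_sec V s) = restrict_sec V (\<phi> W s))))"

lemma sheaf_iso_iff_via: "sheaf_iso E F \<longleftrightarrow> (\<exists>\<phi>. sheaf_iso_via E F \<phi>)"
  unfolding sheaf_iso_def sheaf_iso_via_def ..

lemma sheaf_iso_viaD:
  assumes "sheaf_iso_via E F \<phi>" "zariski_open W"
  shows "bij_betw (\<phi> W) (E W) (F W)"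
    and "s \<in> E W \<Longrightarrow> t \<in> E W \<Longrightarrow> \<phi> W (\<lambda>v. s v + t v) = (\<lambda>v. \<phi> W s v + \<phi> W t v)"
    and "r \<in> twist 0 W \<Longrightarrow> s \<in> E W \<Longrightarrow> \<phi> W (\<lambda>v. r v *s s v) = (\<lambda>v. r v *s \<phi> W s v)"
    and "zariski_open V \<Longrightarrow> V \<subseteq> W \<Longrightarrow> s \<in> E W \<Longrightarrow> \<phi> V (restrict_sec V s) = restrict_sec V (\<phi> W s)"
proof -
  note \<phi> = assms(1)[unfolded sheaf_iso_via_def, THEN spec, THEN mp, OF assms(2)]
  show "bij_betw (\<phi> W) (E W) (F W)" using conjunct1[OF \<phi>] .
  show "\<phi> W (\<lambda>v. s v + t v) = (\<lambda>v. \<phi> W s v + \<phi> W t v)" if "s \<in> E W" "t \<in> E W"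
    using conjunct1[OF conjunct2[OF \<phi>]] that by simp
  show "\<phi> W (\<lambda>v. r v *s s v) = (\<lambda>v. r v *s \<phi> W s v)" if "r \<in> twist 0 W" "s \<in> E W"
    using conjunct1[OF conjunct2[OF conjunct2[OF \<phi>]]] that by simp
  show "\<phi> V (restrict_sec V s) = restrict_sec V (\<phi> W s)" if "zariski_open V" "V \<subseteq> W" "s \<in> E W"
    using conjunct2[OF conjunct2[OF conjunct2[OF \<phi>]]] that by simp
qed

lemma sheaf_iso_sym:
  assumes "sheaf_iso (log_sheaf g) (log_sheaf f)"
  shows "sheaf_iso (log_sheaf f) (log_sheaf g)"
proof -
  obtain \<phi> where via: "sheaf_iso_via (log_sheaf g) (log_sheaf f) \<phi>"
    using assms unfolding sheaf_iso_iff_via ..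
  note \<phi> = sheaf_iso_viaD[OF via]
  define \<psi> where "\<psi> W = inv_into (log_sheaf g W) (\<phi> W)" for W
  have \<psi>: "\<psi> W s \<in> log_sheaf g W" "\<phi> W (\<psi> W s) = s" if "zariski_open W" "s \<in> log_sheaf f W" for W s
    using bij_betw_apply[OF bij_betw_inv_into[OF \<phi>(1)[OF that(1)]] that(2)]
      bij_betw_inv_into_right[OF \<phi>(1)[OF that(1)] that(2)] unfolding \<psi>_def by blast+
  have \<psi>eq: "\<psi> W (\<phi> W s) = s" if "zariski_open W" "s \<in> log_sheaf g W" for W s
    using bij_betw_inv_into_left[OF \<phi>(1)[OF that(1)] that(2)] unfolding \<psi>_def .
  show ?thesis
    unfolding sheaf_iso_iff_via sheaf_iso_via_def
  proof (intro exI[of _ \<psi>] allI impI conjI ballI)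
    fix W assume W: "zariski_open W"
    show "bij_betw (\<psi> W) (log_sheaf f W) (log_sheaf g W)"
      unfolding \<psi>_def by (intro bij_betw_inv_into \<phi>(1) W)
    fix s assume s: "s \<in> log_sheaf f W"
    { fix t assume t: "t \<in> log_sheaf f W"
      have "\<phi> W (\<lambda>v. \<psi> W s v + \<psi> W t v) = (\<lambda>v. s v + t v)"
        using \<phi>(2)[OF W \<psi>(1)[OF W s] \<psi>(1)[OF W t]] \<psi>(2)[OF W s] \<psi>(2)[OF W t] by simp
      then show "\<psi> W (\<lambda>v. s v + t v) = (\<lambda>v. \<psi> W s v + \<psi> W t v)"
        using \<psi>eq[OF W log_sheaf_add[OF \<psi>(1)[OF W s] \<psi>(1)[OF W t]]] by simp }
    { fix V assume V: "zariski_open V \<and> V \<subseteq> W"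
      have "\<phi> V (restrict_sec V (\<psi> W s)) = restrict_sec V s"
        using \<phi>(4)[OF W _ _ \<psi>(1)[OF W s]] V \<psi>(2)[OF W s] by simp
      then show "\<psi> V (restrict_sec V s) = restrict_sec V (\<psi> W s)"
        using \<psi>eq[OF _ log_sheaf_restrict[OF \<psi>(1)[OF W s]]] V by metis }
  next
    fix W r s assume W: "zariski_open W" and r: "r \<in> twist 0 W" and s: "s \<in> log_sheaf f W"
    have "\<phi> W (\<lambda>v. r v *s \<psi> W s v) = (\<lambda>v. r v *s s v)"
      using \<phi>(3)[OF W r \<psi>(1)[OF W s]] \<psi>(2)[OF W s] by simp
    then show "\<psi> W (\<lambda>v. r v *s s v) = (\<lambda>v. r v *s \<psi> W s v)"
      using \<psi>eq[OF W log_sheaf_scale[OF r \<psi>(1)[OF W s]]] by simp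
  qed
qed

definition syz :: "tpoly \<Rightarrow> nat \<Rightarrow> (tpoly^3) set" where
  "syz f m = {\<rho>. dotp \<rho> (grad f) = 0 \<and> hom_vec m \<rho>}"

lemma syz_add: "\<rho> \<in> syz f m \<Longrightarrow> \<sigma> \<in> syz f m \<Longrightarrow> \<rho> + \<sigma> \<in> syz f m"
  and syz_scale: "homogeneous k h \<Longrightarrow> \<rho> \<in> syz f m \<Longrightarrow> h *s \<rho> \<in> syz f (k + m)"
  by (simp_all add: syz_def dotp_simps hom_vec_add hom_vec_scale)

definition evv :: "tpoly^3 \<Rightarrow> complex^3 \<Rightarrow> complex^3" where "evv \<rho> v = (\<chi> j. ev (\<rho> $ j) v)"

lemma evv_nth [simp]: "evv \<rho> v $ j = ev (\<rho> $ j) v"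
  by (simp add: evv_def)

lemma evv_simps: "evv (\<rho> + \<sigma>) v = evv \<rho> v + evv \<sigma> v" "evv (h *s \<rho>) v = ev h v *s evv \<rho> v" "evv 0 v = 0"
  by (simp_all add: vec_eq_iff)

definition chart :: "3 \<Rightarrow> (complex^3) set" where "chart i = Dset (vars $ i)"

lemma chart_eq: "chart i = {v. v $ i \<noteq> 0}"
  by (auto simp: chart_def Dset_def simp del: vars_nth)

lemma zariski_open_chart: "zariski_open (chart i)"
  unfolding chart_def by (rule zariski_open_Dset[OF homogeneous_var])

definition chart_section :: "3 \<Rightarrow> nat \<Rightarrow> tpoly^3 \<Rightarrow> complex^3 \<Rightarrow> complex^3" where
  "chart_section i m \<rho> v = (v $ i / (v $ i) ^ m) *s evv \<rho> v"

lemma chart_section_in_log_sheaf: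
  assumes "\<rho> \<in> syz f m"
  shows "chart_section i m \<rho> \<in> log_sheaf f (chart i)"
proof (rule log_sheafI)
  have h: "hom_vec m \<rho>" "dotp \<rho> (grad f) = 0" using assms by (auto simp: syz_def)
  show "(\<lambda>v. chart_section i m \<rho> v $ j) \<in> twist 1 (chart i)" for j
  proof (rule twist_quotient[OF zariski_open_chart])
    show "homogeneous (1 + m) (vars $ i * \<rho> $ j)"
      using h(1) by (intro homogeneous_mult homogeneous_var) (simp add: hom_vec_def)
    show "homogeneous (m * 1) (vars $ i ^ m)" by (intro homogeneous_power homogeneous_var)
  qed (auto simp: chart_eq chart_section_def simp del: vars_nth)
  fix v :: "complex^3"
  have "ev (dotp \<rho> (grad f)) v = 0" using h(2) by simp
  then have "ev (\<rho> $ 1) v * ev (grad f $ 1) v + ev (\<rho> $ 2) v * ev (grad f $ 2) v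
      + ev (\<rho> $ 3) v * ev (grad f $ 3) v = 0" by (simp add: dotp_def)
  then have "(v $ i / v $ i ^ m) * (ev (\<rho> $ 1) v * ev (grad f $ 1) v + ev (\<rho> $ 2) v * ev (grad f $ 2) v
      + ev (\<rho> $ 3) v * ev (grad f $ 3) v) = 0" by simp
  then show "chart_section i m \<rho> v $ 1 * ev (grad f $ 1) v + chart_section i m \<rho> v $ 2 * ev (grad f $ 2) v
      + chart_section i m \<rho> v $ 3 * ev (grad f $ 3) v = 0"
    by (simp only: chart_section_def vector_smult_component evv_nth distrib_left mult.assoc)
qed

definition syz_embedding :: "tpoly \<Rightarrow> tpoly \<Rightarrow> (nat \<Rightarrow> tpoly^3 \<Rightarrow> tpoly^3) \<Rightarrow> bool" where
  "syz_embedding g f \<Psi> \<longleftrightarrow>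
     (\<forall>m. \<forall>\<rho>\<in>syz g m. \<Psi> m \<rho> \<in> syz f m) \<and>
     (\<forall>m. \<forall>\<rho>\<in>syz g m. \<forall>\<sigma>\<in>syz g m. \<Psi> m (\<rho> + \<sigma>) = \<Psi> m \<rho> + \<Psi> m \<sigma>) \<and>
     (\<forall>m k h. \<forall>\<rho>\<in>syz g m. homogeneous k h \<longrightarrow> \<Psi> (k + m) (h *s \<rho>) = h *s \<Psi> m \<rho>) \<and>
     (\<forall>m. \<forall>\<rho>\<in>syz g m. \<Psi> m \<rho> = 0 \<longrightarrow> \<rho> = 0)"

lemma syz_embeddingI:
  assumes "\<And>m \<rho>. \<rho> \<in> syz g m \<Longrightarrow> \<Psi> m \<rho> \<in> syz f m"
    "\<And>m \<rho> \<sigma>. \<rho> \<in> syz g m \<Longrightarrow> \<sigma> \<in> syz g m \<Longrightarrow> \<Psi> m (\<rho> + \<sigma>) = \<Psi> m \<rho> + \<Psi> m \<sigma>"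
    "\<And>m k h \<rho>. \<rho> \<in> syz g m \<Longrightarrow> homogeneous k h \<Longrightarrow> \<Psi> (k + m) (h *s \<rho>) = h *s \<Psi> m \<rho>"
    "\<And>m \<rho>. \<rho> \<in> syz g m \<Longrightarrow> \<Psi> m \<rho> = 0 \<Longrightarrow> \<rho> = 0"
  shows "syz_embedding g f \<Psi>"
  unfolding syz_embedding_def
proof (intro conjI)
  show "\<forall>m. \<forall>\<rho>\<in>syz g m. \<Psi> m \<rho> \<in> syz f m" by (intro allI ballI) (rule assms(1))
  show "\<forall>m. \<forall>\<rho>\<in>syz g m. \<forall>\<sigma>\<in>syz g m. \<Psi> m (\<rho> + \<sigma>) = \<Psi> m \<rho> + \<Psi> m \<sigma>"
    by (intro allI ballI) (rule assms(2))
  show "\<forall>m k h. \<forall>\<rho>\<in>syz g m. homogeneous k h \<longrightarrow> \<Psi> (k + m) (h *s \<rho>) = h *s \<Psi> m \<rho>"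
    by (intro allI ballI impI) (rule assms(3))
  show "\<forall>m. \<forall>\<rho>\<in>syz g m. \<Psi> m \<rho> = 0 \<longrightarrow> \<rho> = 0"
    by (intro allI ballI impI) (rule assms(4))
qed

lemma syz_embeddingD:
  assumes "syz_embedding g f \<Psi>" "\<rho> \<in> syz g m"
  shows "\<Psi> m \<rho> \<in> syz f m"
    and "\<sigma> \<in> syz g m \<Longrightarrow> \<Psi> m (\<rho> + \<sigma>) = \<Psi> m \<rho> + \<Psi> m \<sigma>"
    and "homogeneous k h \<Longrightarrow> \<Psi> (k + m) (h *s \<rho>) = h *s \<Psi> m \<rho>"
    and "\<Psi> m \<rho> = 0 \<Longrightarrow> \<rho> = 0"
  using assms(1)[unfolded syz_embedding_def] assms(2) by simp_all

text \<open>An isomorphism of sheaves induces an injective homomorphism of the graded modules of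
  global sections of all twists. It is computed on the three coordinate charts and glued.\<close>

lemma sheaf_iso_syzygies:
  assumes "sheaf_iso (log_sheaf g) (log_sheaf f)"
  shows "\<exists>\<Psi>. syz_embedding g f \<Psi>"
proof -
  obtain \<phi> where via: "sheaf_iso_via (log_sheaf g) (log_sheaf f) \<phi>"
    using assms unfolding sheaf_iso_iff_via ..
  note \<phi> = sheaf_iso_viaD[OF via]
  have \<phi>in: "\<phi> W s \<in> log_sheaf f W" if "zariski_open W" "s \<in> log_sheaf g W" for W s
    using \<phi>(1)[OF that(1)] that(2) by (auto simp: bij_betw_def)
  define t where "t i m \<rho> = \<phi> (chart i) (chart_section i m \<rho>)" for i m \<rho>
  have t_in: "t i m \<rho> \<in> log_sheaf f (chart i)" if "\<rho> \<in> syz g m" for i m \<rho>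
    unfolding t_def by (intro \<phi>in zariski_open_chart chart_section_in_log_sheaf that)
  have glue: "((v $ i) ^ m / v $ i) *s t i m \<rho> v = ((v $ j) ^ m / v $ j) *s t j m \<rho> v"
    if \<rho>: "\<rho> \<in> syz g m" and v: "v $ i \<noteq> 0" "v $ j \<noteq> 0" for m \<rho> i j v
  proof -
    define W where "W = chart i \<inter> chart j"
    have W: "zariski_open W" "W \<subseteq> chart i" "W \<subseteq> chart j" "v \<in> W"
      using v by (auto simp: W_def chart_eq intro: zariski_open_Int zariski_open_chart[unfolded chart_eq])
    define r where "r v = (if v \<in> W then (v $ i / v $ i ^ m) * (v $ j ^ m / v $ j) else 0)" for v :: "complex^3"
    have r: "r \<in> twist 0 W"
    proof (rule twist_quotient[OF W(1)])
      show "homogeneous (1 + m * 1) (vars $ i * vars $ j ^ m)" "homogeneous (1 + m * 1) (vars $ j * vars $ i ^ m)"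
        by (intro homogeneous_mult homogeneous_var homogeneous_power)+
    qed (auto simp: r_def W_def chart_eq simp del: vars_nth)
    let ?s = "\<lambda>i. restrict_sec W (chart_section i m \<rho>)"
    have s: "?s j \<in> log_sheaf g W"
      by (intro log_sheaf_restrict[OF chart_section_in_log_sheaf[OF \<rho>]] W)
    have "?s i = (\<lambda>v. r v *s ?s j v)"
      by (auto simp: restrict_sec_def r_def chart_section_def W_def chart_eq fun_eq_iff vec_eq_iff)
    then have "\<phi> W (?s i) = (\<lambda>v. r v *s \<phi> W (?s j) v)" using \<phi>(3)[OF W(1) r s] by simp
    then have "restrict_sec W (t i m \<rho>) = (\<lambda>v. r v *s restrict_sec W (t j m \<rho>) v)"
      unfolding t_def
      using \<phi>(4)[OF zariski_open_chart W(1,2) chart_section_in_log_sheaf[OF \<rho>]]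
        \<phi>(4)[OF zariski_open_chart W(1,3) chart_section_in_log_sheaf[OF \<rho>]] by simp
    from fun_cong[OF this, of v] have tv: "t i m \<rho> v = r v *s t j m \<rho> v"
      unfolding restrict_sec_def if_P[OF W(4)] .
    have "(v $ i ^ m / v $ i) * r v = v $ j ^ m / v $ j" using v W(4) by (simp add: r_def)
    then show ?thesis unfolding tv by (simp only: vector_smult_assoc)
  qed
  have ex: "\<exists>\<sigma>. \<sigma> \<in> syz f m \<and> (\<forall>i v. v $ i \<noteq> 0 \<longrightarrow> evv \<sigma> v = ((v $ i) ^ m / v $ i) *s t i m \<rho> v)"
    if \<rho>: "\<rho> \<in> syz g m" for m \<rho>
  proof -
    define S where "S v = (if v = 0 then 0 else
      let i = (SOME i. v $ i \<noteq> 0) in ((v $ i) ^ m / v $ i) *s t i m \<rho> v)" for v :: "complex^3"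
    have S: "S v = ((v $ i) ^ m / v $ i) *s t i m \<rho> v" if "v $ i \<noteq> 0" for v i
    proof -
      define l where "l = (SOME i. v $ i \<noteq> 0)"
      have l: "v $ l \<noteq> 0" unfolding l_def using that by (rule someI)
      have "v \<noteq> 0" using that by auto
      then have "S v = ((v $ l) ^ m / v $ l) *s t l m \<rho> v" unfolding S_def Let_def l_def by (rule if_not_P)
      also have "\<dots> = ((v $ i) ^ m / v $ i) *s t i m \<rho> v" by (rule glue[OF \<rho> l that])
      finally show ?thesis .
    qed
    have "(\<lambda>v. S v $ j) \<in> twist (int m) {v. v \<noteq> 0}" for j
    proof (rule twistI)
      fix w :: "complex^3" assume "w \<in> {v. v \<noteq> 0}"
      then obtain i where i: "w $ i \<noteq> 0" by (auto simp: vec_eq_iff)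
      then have "w \<in> chart i" by (simp add: chart_eq)
      obtain V G H a b where V: "zariski_open V" "w \<in> V" "V \<subseteq> chart i" "homogeneous a G" "homogeneous b H"
          "int a - int b = 1" "\<And>v. v \<in> V \<Longrightarrow> ev H v \<noteq> 0" "\<And>v. v \<in> V \<Longrightarrow> t i m \<rho> v $ j = ev G v / ev H v"
        using twistE[OF log_sheafD(1)[OF t_in[OF \<rho>]] \<open>w \<in> chart i\<close>] by metis
      have "homogeneous (m * 1 + a) (vars $ i ^ m * G)" "homogeneous (1 + b) (vars $ i * H)"
        by (intro homogeneous_mult homogeneous_power homogeneous_var V)+
      moreover have "int (m * 1 + a) - int (1 + b) = int m" using V(6) by simp
      moreover have "V \<subseteq> {v. v \<noteq> 0}" using V(3) by (auto simp: chart_eq)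
      moreover have "ev (vars $ i * H) v \<noteq> 0 \<and> S v $ j = ev (vars $ i ^ m * G) v / ev (vars $ i * H) v"
        if "v \<in> V" for v
      proof -
        have "v $ i \<noteq> 0" using that V(3) by (auto simp: chart_eq)
        then show ?thesis using V(7,8)[OF that] by (simp add: S del: vars_nth)
      qed
      ultimately show "\<exists>V G H m' n. zariski_open V \<and> w \<in> V \<and> V \<subseteq> {v. v \<noteq> 0} \<and>
            homogeneous m' G \<and> homogeneous n H \<and> int m' - int n = int m \<and>
            (\<forall>v\<in>V. ev H v \<noteq> 0 \<and> S v $ j = ev G v / ev H v)"
        using V(1,2) by blast
    qed (simp add: S_def)
    then have "\<forall>j. \<exists>P. homogeneous m P \<and> (\<forall>v. v \<noteq> 0 \<longrightarrow> S v $ j = ev P v)"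
      using global_sections_twist by metis
    then obtain P where P: "\<And>j. homogeneous m (P j)" "\<And>j v. v \<noteq> 0 \<Longrightarrow> S v $ j = ev (P j) v" by metis
    define \<sigma> where "\<sigma> = (\<chi> j. P j)"
    have e: "evv \<sigma> v = ((v $ i) ^ m / v $ i) *s t i m \<rho> v" if "v $ i \<noteq> 0" for v i
    proof -
      have "v \<noteq> 0" using that by auto
      then have "evv \<sigma> v = S v" using P(2) by (simp add: vec_eq_iff \<sigma>_def)
      then show ?thesis using S[OF that] by simp
    qed
    have "dotp \<sigma> (grad f) = 0"
    proof (rule ev_eqI)
      fix v :: "complex^3" assume "v \<noteq> 0"
      then obtain i where i: "v $ i \<noteq> 0" by (auto simp: vec_eq_iff)
      have c: "ev (\<sigma> $ j) v = ((v $ i) ^ m / v $ i) * t i m \<rho> v $ j" for j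
        using arg_cong[OF e[OF i], of "\<lambda>x. x $ j"] by simp
      have "v \<in> chart i" using i by (simp add: chart_eq)
      from log_sheafD(2)[OF t_in[OF \<rho>] this]
      have "((v $ i) ^ m / v $ i) * (t i m \<rho> v $ 1 * ev (grad f $ 1) v + t i m \<rho> v $ 2 * ev (grad f $ 2) v
          + t i m \<rho> v $ 3 * ev (grad f $ 3) v) = 0" by simp
      then show "ev (dotp \<sigma> (grad f)) v = ev 0 v"
        by (simp only: dotp_def ev_simps c distrib_left mult.assoc)
    qed
    then show ?thesis using e P(1) by (intro exI[of _ \<sigma>]) (simp add: syz_def hom_vec_def \<sigma>_def)
  qed
  define \<Psi> where "\<Psi> m \<rho> = (SOME \<sigma>. \<sigma> \<in> syz f m \<and>
      (\<forall>i v. v $ i \<noteq> 0 \<longrightarrow> evv \<sigma> v = ((v $ i) ^ m / v $ i) *s t i m \<rho> v))" for m \<rho>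
  have \<Psi>: "\<Psi> m \<rho> \<in> syz f m" "\<And>i v. v $ i \<noteq> 0 \<Longrightarrow> evv (\<Psi> m \<rho>) v = ((v $ i) ^ m / v $ i) *s t i m \<rho> v"
    if "\<rho> \<in> syz g m" for m \<rho>
    using someI_ex[OF ex[OF that]] unfolding \<Psi>_def by blast+
  have eqI: "\<sigma> = \<tau>" if "\<And>i v. v $ i \<noteq> 0 \<Longrightarrow> evv \<sigma> v = evv \<tau> v" for \<sigma> \<tau>
  proof -
    have "ev (\<sigma> $ j) v = ev (\<tau> $ j) v" if "v \<noteq> 0" for j v
    proof -
      obtain i where "v $ i \<noteq> 0" using \<open>v \<noteq> 0\<close> by (auto simp: vec_eq_iff)
      then show ?thesis using arg_cong[OF \<open>\<And>i v. v $ i \<noteq> 0 \<Longrightarrow> evv \<sigma> v = evv \<tau> v\<close>, of v i "\<lambda>x. x $ j"] by simp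
    qed
    then have "\<sigma> $ j = \<tau> $ j" for j by (rule ev_eqI)
    then show ?thesis by (simp add: vec_eq_iff)
  qed
  have "syz_embedding g f \<Psi>"
  proof (rule syz_embeddingI)
    show "\<Psi> m \<rho> \<in> syz f m" if "\<rho> \<in> syz g m" for m \<rho> using \<Psi>(1)[OF that] .
  next
    fix m \<rho> \<sigma> assume r: "\<rho> \<in> syz g m" "\<sigma> \<in> syz g m"
    have "t i m (\<rho> + \<sigma>) = (\<lambda>v. t i m \<rho> v + t i m \<sigma> v)" for i
    proof -
      have "chart_section i m (\<rho> + \<sigma>) = (\<lambda>v. chart_section i m \<rho> v + chart_section i m \<sigma> v)"
        by (simp add: chart_section_def evv_simps fun_eq_iff vector_add_ldistrib)
      then show ?thesis unfolding t_def
        using \<phi>(2)[OF zariski_open_chart chart_section_in_log_sheaf[OF r(1)] chart_section_in_log_sheaf[OF r(2)]]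
        by simp
    qed
    then show "\<Psi> m (\<rho> + \<sigma>) = \<Psi> m \<rho> + \<Psi> m \<sigma>"
      by (intro eqI) (simp add: evv_simps \<Psi>(2)[OF r(1)] \<Psi>(2)[OF r(2)] \<Psi>(2)[OF syz_add[OF r]] vector_add_ldistrib)
  next
    fix m k h \<rho> assume r: "\<rho> \<in> syz g m" and h: "homogeneous k h"
    have t: "t i (k + m) (h *s \<rho>) v = (ev h v / v $ i ^ k) *s t i m \<rho> v" if "v $ i \<noteq> 0" for i v
    proof -
      define q where "q v = (if v \<in> chart i then ev h v / v $ i ^ k else 0)" for v :: "complex^3"
      have q: "q \<in> twist 0 (chart i)"
      proof (rule twist_quotient[OF zariski_open_chart h])
        show "homogeneous (k * 1) (vars $ i ^ k)" by (intro homogeneous_power homogeneous_var)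
      qed (auto simp: q_def chart_eq simp del: vars_nth)
      have "chart_section i (k + m) (h *s \<rho>) = (\<lambda>v. q v *s chart_section i m \<rho> v)"
        by (auto simp: chart_section_def evv_simps fun_eq_iff q_def chart_eq vec_eq_iff power_add field_simps)
      then have "t i (k + m) (h *s \<rho>) = (\<lambda>v. q v *s t i m \<rho> v)" unfolding t_def
        using \<phi>(3)[OF zariski_open_chart q chart_section_in_log_sheaf[OF r]] by simp
      then show ?thesis using that by (simp add: q_def chart_eq)
    qed
    show "\<Psi> (k + m) (h *s \<rho>) = h *s \<Psi> m \<rho>"
    proof (rule eqI)
      fix i and v :: "complex^3" assume v: "v $ i \<noteq> 0"
      show "evv (\<Psi> (k + m) (h *s \<rho>)) v = evv (h *s \<Psi> m \<rho>) v"
        unfolding evv_simps \<Psi>(2)[OF r v] \<Psi>(2)[OF syz_scale[OF h r] v] t[OF v]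
        using v by (simp add: vec_eq_iff power_add field_simps)
    qed
  next
    fix m \<rho> assume r: "\<rho> \<in> syz g m" and z: "\<Psi> m \<rho> = 0"
    have "t 1 m \<rho> v = 0" for v
    proof (cases "v $ 1 = 0")
      case True
      then show ?thesis using log_sheaf_outside[OF t_in[OF r]] by (simp add: chart_eq)
    next
      case False
      then show ?thesis using \<Psi>(2)[OF r False] z by (simp add: evv_simps vec_eq_iff)
    qed
    then have t0: "\<phi> (chart 1) (chart_section 1 m \<rho>) = (\<lambda>v. 0)" by (simp add: t_def fun_eq_iff)
    have zero: "0 \<in> syz g 0" by (simp add: syz_def dotp_simps hom_vec_def)
    have zs: "chart_section 1 0 0 = (\<lambda>v. 0)" by (simp add: chart_section_def evv_simps fun_eq_iff)
    have z: "(\<lambda>v. 0) \<in> log_sheaf g (chart 1)"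
      using chart_section_in_log_sheaf[OF zero, of 1] by (simp add: zs)
    have "\<phi> (chart 1) (\<lambda>v. 0) = (\<lambda>v. 0)"
    proof -
      have "\<phi> (chart 1) (\<lambda>v. 0) = (\<lambda>v. \<phi> (chart 1) (\<lambda>v. 0) v + \<phi> (chart 1) (\<lambda>v. 0) v)"
        using \<phi>(2)[OF zariski_open_chart z z] by simp
      then show ?thesis by (metis add_cancel_right_right)
    qed
    then have "chart_section 1 m \<rho> = (\<lambda>v. 0)"
      using t0 \<phi>(1)[OF zariski_open_chart, of 1] chart_section_in_log_sheaf[OF r, of 1] z
      by (metis bij_betw_def inj_onD)
    then have c: "chart_section 1 m \<rho> v = 0" for v by metis
    have "vars $ 1 * \<rho> $ j = 0" for j
    proof (rule ev_eqI)
      fix v :: "complex^3"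
      show "ev (vars $ 1 * \<rho> $ j) v = ev 0 v"
        using arg_cong[OF c[of v], of "\<lambda>x. x $ j"] by (auto simp: chart_section_def simp del: vars_nth)
    qed
    then show "\<rho> = 0" by (simp add: vec_eq_iff)
  qed
  then show ?thesis by (rule exI[of _ \<Psi>])
qed



section \<open>Recovering the gradient and the curve\<close>

lemma cr_axis_sum: "cr a b = a $ 1 *s cr (axis 1 1) b + a $ 2 *s cr (axis 2 1) b + a $ 3 *s cr (axis 3 1) b"
  by (simp add: vec3_eq_iff axis_def algebra_simps)

lemma koszul_syz: "homogeneous d f \<Longrightarrow> hom_vec k a \<Longrightarrow> cr a (grad f) \<in> syz f (k + (d - 1))"
  using hom_vec_cr[OF _ hom_vec_grad] by (simp add: syz_def dotp_cr)

lemma hom_vec_axis: "hom_vec 0 (axis i 1)"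
  by (simp add: hom_vec_def axis_def)

lemma image_of_koszul_syzygy:
  assumes g: "homogeneous e g"
    and \<Psi>: "syz_embedding g f \<Psi>" and h: "hom_vec k h"
  shows "\<Psi> (k + (e - 1)) (cr h (grad g)) = h $ 1 *s \<Psi> (e - 1) (cr (axis 1 1) (grad g))
    + h $ 2 *s \<Psi> (e - 1) (cr (axis 2 1) (grad g)) + h $ 3 *s \<Psi> (e - 1) (cr (axis 3 1) (grad g))"
proof -
  have \<kappa>: "cr (axis i 1) (grad g) \<in> syz g (e - 1)" for i
    using koszul_syz[OF g hom_vec_axis] by simp
  have hi: "homogeneous k (h $ i)" for i using h by (simp add: hom_vec_def)
  have hk: "h $ i *s cr (axis i 1) (grad g) \<in> syz g (k + (e - 1))" for i
    by (rule syz_scale[OF hi \<kappa>])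
  show ?thesis
    by (subst cr_axis_sum) (simp only: syz_embeddingD(2)[OF \<Psi> syz_add[OF hk hk] hk] syz_embeddingD(2)[OF \<Psi> hk hk]
        syz_embeddingD(3)[OF \<Psi> \<kappa> hi])
qed

lemma linear_combinations_of_gradients:
  fixes a :: "3 \<Rightarrow> complex^3"
  assumes inj: "\<And>x :: complex^3. x $ 1 *s a 1 + x $ 2 *s a 2 + x $ 3 *s a 3 = 0 \<Longrightarrow> x = 0"
    and rel: "G $ 1 *s constv (a 1) + G $ 2 *s constv (a 2) + G $ 3 *s constv (a 3) = const c *s F"
  shows "\<exists>w'. dotp (constv w) G = dotp (constv w') F"
proof -
  define M where "M = (\<chi> j i. a i $ j)"
  have "M *v x = x $ 1 *s a 1 + x $ 2 *s a 2 + x $ 3 *s a 3" for x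
    by (simp add: vec_eq_iff matrix_vector_mult_def M_def sum_3 mult.commute)
  then obtain B where B: "B ** M = mat 1"
    using inj matrix_left_invertible_ker[of M] by metis
  define x where "x = w v* B"
  have "x v* M = w" unfolding x_def vector_matrix_mul_assoc B by simp
  then have xw: "x $ 1 * a i $ 1 + x $ 2 * a i $ 2 + x $ 3 * a i $ 3 = w $ i" for i
    by (auto simp: vector_matrix_mult_def M_def sum_3 vec_eq_iff mult.commute)
  have r: "G $ 1 * const (a 1 $ j) + G $ 2 * const (a 2 $ j) + G $ 3 * const (a 3 $ j) = const c * F $ j" for j
    using arg_cong[OF rel, of "\<lambda>v. v $ j"] by simp
  have "dotp (constv w) G = const (x $ 1) * (const c * F $ 1) + const (x $ 2) * (const c * F $ 2)
      + const (x $ 3) * (const c * F $ 3)"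
    unfolding r[symmetric] dotp_def constv_nth xw[symmetric]
    by (simp add: const_add const_mult algebra_simps)
  also have "\<dots> = dotp (constv (c *s x)) F"
    by (simp add: dotp_def const_mult algebra_simps)
  finally show ?thesis by blast
qed

lemma nodal_gradient_determined:
  assumes f: "reduced_curve d f" "nodal f" "d \<ge> 3" "finite (nodes f)" "card (nodes f) + 3 \<le> d"
    and g: "reduced_curve e g" and iso: "sheaf_iso (log_sheaf g) (log_sheaf f)"
  shows "e = d \<and> (\<forall>w. \<exists>w'. D w g = D w' f)"
proof -
  have hf: "homogeneous d f" and hg: "homogeneous e g" "e \<ge> 1"
    using f(1) g by (auto simp: reduced_curve_def)
  have d2: "d \<ge> 2" using f(3) by simp
  note cf = coprime3_grad[OF f(1)] and cg = coprime3_grad[OF g]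
  note low = nodal_low_degree_syzygies[OF f(1,2) d2 f(4,5)]
  define \<kappa> where "\<kappa> i = cr (axis i 1) (grad g)" for i :: 3
  define \<kappa>' where "\<kappa>' i = cr (axis i 1) (grad f)" for i :: 3
  have \<kappa>: "\<kappa> i \<in> syz g (e - 1)" for i
    using koszul_syz[OF hg(1) hom_vec_axis] by (simp add: \<kappa>_def)
  have \<kappa>': "\<kappa>' i \<in> syz f (d - 1)" for i
    using koszul_syz[OF hf hom_vec_axis] by (simp add: \<kappa>'_def)
  obtain \<Psi> where emb: "syz_embedding g f \<Psi>" using sheaf_iso_syzygies[OF iso] by blast
  note \<Psi> = syz_embeddingD[OF emb]
  note \<Psi>cr = image_of_koszul_syzygy[OF hg(1) emb, folded \<kappa>_def]
  have "\<not> e < d"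
  proof
    assume "e < d"
    then have lt: "e - 1 \<le> d - 1" "e - 1 < d - 1" using hg(2) by auto
    have "\<kappa> i = 0" for i
    proof -
      have "dotp (\<Psi> (e - 1) (\<kappa> i)) (grad f) = 0" "hom_vec (e - 1) (\<Psi> (e - 1) (\<kappa> i))"
        using \<Psi>(1)[OF \<kappa>] by (auto simp: syz_def)
      then have "\<Psi> (e - 1) (\<kappa> i) = 0" using low lt by metis
      then show ?thesis using \<Psi>(4)[OF \<kappa>] by blast
    qed
    from this[of 1] this[of 2] have "grad g = 0" by (simp add: \<kappa>_def vec3_eq_iff axis_def)
    then show False using coprime3_nonzero[OF cg] by simp
  qed
  moreover have "\<not> d < e"
  proof
    assume de: "d < e"
    obtain \<Phi> where emb': "syz_embedding f g \<Phi>"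
      using sheaf_iso_syzygies[OF sheaf_iso_sym[OF iso]] by blast
    note \<Phi> = syz_embeddingD[OF emb']
    note \<Phi>cr = image_of_koszul_syzygy[OF hf emb', folded \<kappa>'_def]
    define \<sigma> where "\<sigma> i = \<Phi> (d - 1) (\<kappa>' i)" for i
    have \<sigma>: "dotp (\<sigma> i) (grad g) = 0" "hom_vec (d - 1) (\<sigma> i)" for i
      using \<Phi>(1)[OF \<kappa>'] by (auto simp: syz_def \<sigma>_def)
    have zero: "\<Phi> (k + (d - 1)) 0 = 0" for k
    proof -
      have "0 \<in> syz f (k + (d - 1))" by (simp add: syz_def dotp_simps hom_vec_def)
      then show ?thesis using \<Phi>(2)[of 0 "k + (d - 1)" 0] by simp
    qed
    have "\<exists>q. cr (\<sigma> i) (\<sigma> j) = q *s grad g" for i j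
    proof -
      have "cr (cr (\<sigma> i) (\<sigma> j)) (grad g) = 0" by (simp add: cr_cr \<sigma>)
      then show ?thesis using parallel_coprime3[OF cg] by metis
    qed
    then obtain q1 q2 q3 where q: "cr (\<sigma> 2) (\<sigma> 3) = q1 *s grad g" "cr (\<sigma> 3) (\<sigma> 1) = q2 *s grad g"
      "cr (\<sigma> 1) (\<sigma> 2) = q3 *s grad g" by metis
    define k where "k = (d - 1 + (d - 1)) - (e - 1)"
    have kd: "k < d - 1" using de f(3) by (simp add: k_def)
    have qh: "homogeneous k q" if "cr (\<sigma> i) (\<sigma> j) = q *s grad g" for q i j
    proof -
      have "hom_vec (d - 1 + (d - 1)) (q *s grad g)"
        using hom_vec_cr[OF \<sigma>(2) \<sigma>(2)] that by metis
      from hom_vec_multiple[OF hom_vec_grad[OF hg(1)] coprime3_nonzero[OF cg] this]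
      show ?thesis using coprime3_nonzero[OF cg] by (auto simp: k_def vec_eq_iff)
    qed
    define Q where "Q = (vector [q1, q2, q3] :: tpoly^3)"
    have Qn: "Q $ 1 = q1" "Q $ 2 = q2" "Q $ 3 = q3" by (simp_all add: Q_def vector_3)
    have hQ: "hom_vec k Q" using qh q by (auto simp: hom_vec_def forall_3 Qn)
    let ?F = "grad f"
    have "?F $ 1 *s \<sigma> 1 + ?F $ 2 *s \<sigma> 2 + ?F $ 3 *s \<sigma> 3 = 0"
      using \<Phi>cr[OF hom_vec_grad[OF hf]] unfolding \<sigma>_def cr_simps zero by (rule sym)
    then have z: "cr (?F $ 1 *s \<sigma> 1 + ?F $ 2 *s \<sigma> 2 + ?F $ 3 *s \<sigma> 3) (\<sigma> i) = 0" for i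
      by (simp add: cr_simps)
    have sw: "cr (\<sigma> 3) (\<sigma> 2) = - (q1 *s grad g)" "cr (\<sigma> 1) (\<sigma> 3) = - (q2 *s grad g)"
      "cr (\<sigma> 2) (\<sigma> 1) = - (q3 *s grad g)"
      using q by (metis cr_swap)+
    have "(?F $ 3 * q2 - ?F $ 2 * q3) *s grad g = 0" "(?F $ 1 * q3 - ?F $ 3 * q1) *s grad g = 0"
      "(?F $ 2 * q1 - ?F $ 1 * q2) *s grad g = 0"
      using z[of 1] z[of 2] z[of 3] unfolding cr_simps q sw
      by (simp_all add: vec_eq_iff algebra_simps)
    moreover have "x = y" if "(x - y) *s grad g = 0" for x y
    proof -
      obtain i where i: "grad g $ i \<noteq> 0" using coprime3_nonzero[OF cg] by (auto simp: vec_eq_iff)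
      have "(x - y) * grad g $ i = 0" using arg_cong[OF that, of "\<lambda>v. v $ i"] by auto
      then show ?thesis using i by simp
    qed
    ultimately have "?F $ 3 * q2 = ?F $ 2 * q3" "?F $ 1 * q3 = ?F $ 3 * q1" "?F $ 2 * q1 = ?F $ 1 * q2"
      by blast+
    then have "cr Q ?F = 0" by (simp add: vec3_eq_iff Qn mult.commute)
    then obtain h where h: "Q = h *s ?F" using parallel_coprime3[OF cf] by blast
    have "Q = 0"
      using hom_vec_multiple[OF hom_vec_grad[OF hf] coprime3_nonzero[OF cf], of k h] hQ kd unfolding h by auto
    then have s12: "cr (\<sigma> 1) (\<sigma> 2) = 0" using q(3) Qn by simp
    have F3: "?F $ 3 \<noteq> 0"
    proof
      assume "?F $ 3 = 0"
      then have "dotp (axis 3 1) ?F = 0" by (simp add: dotp_axis)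
      from low[OF this hom_vec_axis] have "axis 3 (1 :: tpoly) = 0" using f(3) by force
      then show False by simp
    qed
    have "\<sigma> 1 $ i = 0" for i
    proof -
      define h where "h = (vector [- \<sigma> 2 $ i, \<sigma> 1 $ i, 0] :: tpoly^3)"
      have hn: "h $ 1 = - \<sigma> 2 $ i" "h $ 2 = \<sigma> 1 $ i" "h $ 3 = 0" by (simp_all add: h_def vector_3)
      have hh: "hom_vec (d - 1) h"
      proof -
        have "homogeneous (d - 1) (\<sigma> l $ i)" for l using \<sigma>(2) unfolding hom_vec_def by blast
        then show ?thesis unfolding hom_vec_def forall_3 hn by (intro conjI homogeneous_minus homogeneous_0)
      qed
      have e: "\<sigma> 1 $ j * \<sigma> 2 $ l = \<sigma> 1 $ l * \<sigma> 2 $ j" for j l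
      proof -
        have "\<sigma> 1 $ 2 * \<sigma> 2 $ 3 = \<sigma> 1 $ 3 * \<sigma> 2 $ 2" "\<sigma> 1 $ 3 * \<sigma> 2 $ 1 = \<sigma> 1 $ 1 * \<sigma> 2 $ 3"
          "\<sigma> 1 $ 1 * \<sigma> 2 $ 2 = \<sigma> 1 $ 2 * \<sigma> 2 $ 1" using s12 by (simp_all add: vec3_eq_iff)
        then show ?thesis using exhaust_3[of j] exhaust_3[of l] by metis
      qed
      have "\<Phi> (d - 1 + (d - 1)) (cr h ?F) = 0"
        unfolding \<Phi>cr[OF hh] hn \<sigma>_def[symmetric] using e by (simp add: vec_eq_iff mult.commute)
      then have "cr h ?F = 0" using \<Phi>(4)[OF koszul_syz[OF hf hh]] by blast
      then obtain t where t: "h = t *s ?F" using parallel_coprime3[OF cf] by blast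
      have "t * ?F $ 3 = 0" using arg_cong[OF t, of "\<lambda>x. x $ 3"] hn by simp
      then have "t = 0" using F3 by simp
      then show ?thesis using arg_cong[OF t, of "\<lambda>x. x $ 2"] hn by simp
    qed
    then have "\<Phi> (d - 1) (\<kappa>' 1) = 0" by (simp add: vec_eq_iff \<sigma>_def)
    then have "\<kappa>' 1 = 0" using \<Phi>(4)[OF \<kappa>'] by blast
    then have "?F $ 3 = 0" by (simp add: \<kappa>'_def vec3_eq_iff axis_def)
    then show False using F3 by simp
  qed
  ultimately have ed: "e = d" by simp
  have "\<exists>a. \<Psi> (e - 1) (\<kappa> i) = cr (constv a) (grad f)" for i
  proof -
    have "dotp (\<Psi> (e - 1) (\<kappa> i)) (grad f) = 0" "hom_vec (e - 1) (\<Psi> (e - 1) (\<kappa> i))"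
      using \<Psi>(1)[OF \<kappa>] by (auto simp: syz_def)
    then show ?thesis using low ed by (metis le_refl)
  qed
  then obtain a where a: "\<And>i. \<Psi> (e - 1) (\<kappa> i) = cr (constv (a i)) (grad f)" by metis
  have cra: "h $ 1 *s cr (constv (a 1)) (grad f) + h $ 2 *s cr (constv (a 2)) (grad f)
      + h $ 3 *s cr (constv (a 3)) (grad f)
      = cr (h $ 1 *s constv (a 1) + h $ 2 *s constv (a 2) + h $ 3 *s constv (a 3)) (grad f)" for h
    by (simp add: cr_simps)
  have inj: "x = 0" if x: "x $ 1 *s a 1 + x $ 2 *s a 2 + x $ 3 *s a 3 = 0" for x :: "complex^3"
  proof -
    have hx: "hom_vec 0 (constv x)" by (simp add: hom_vec_def)
    have "const (x $ 1) *s constv (a 1) + const (x $ 2) *s constv (a 2) + const (x $ 3) *s constv (a 3) = 0"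
      using arg_cong[OF x, of constv] by (simp add: constv_simps)
    then have "\<Psi> (0 + (e - 1)) (cr (constv x) (grad g)) = 0"
      unfolding \<Psi>cr[OF hx] a cra by (simp add: cr_simps(7))
    then have "cr (constv x) (grad g) = 0" using \<Psi>(4)[OF koszul_syz[OF hg(1) hx]] by blast
    then obtain h where h: "constv x = h *s grad g" using parallel_coprime3[OF cg] by blast
    have "h *s grad g = 0"
      using hom_vec_multiple[OF hom_vec_grad[OF hg(1)] coprime3_nonzero[OF cg], of 0 h] hx f(3) ed
      unfolding h by auto
    then have "constv x = 0" using h by simp
    then show ?thesis by (simp add: vec_eq_iff)
  qed
  define G where "G = grad g $ 1 *s constv (a 1) + grad g $ 2 *s constv (a 2) + grad g $ 3 *s constv (a 3)"
  have "\<Psi> (e - 1 + (e - 1)) (cr (grad g) (grad g)) = cr G (grad f)"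
    unfolding \<Psi>cr[OF hom_vec_grad[OF hg(1)]] a cra G_def ..
  moreover have "\<Psi> (e - 1 + (e - 1)) 0 = 0"
  proof -
    have "0 \<in> syz g (e - 1 + (e - 1))" by (simp add: syz_def dotp_simps hom_vec_def)
    then show ?thesis using \<Psi>(2)[of 0 "e - 1 + (e - 1)" 0] by simp
  qed
  ultimately have "cr G (grad f) = 0" by (simp add: cr_simps)
  then obtain h where h: "G = h *s grad f" using parallel_coprime3[OF cf] by blast
  have "hom_vec (d - 1) G"
    using hom_vec_grad[OF hg(1)] unfolding G_def ed[symmetric] hom_vec_def
    by (simp add: homogeneous_add homogeneous_const_mult mult.commute[of _ "const _"])
  then have "homogeneous 0 h"
    using hom_vec_multiple[OF hom_vec_grad[OF hf] coprime3_nonzero[OF cf], of "d - 1" h] unfolding h by auto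
  then obtain c where c: "h = const c" using homogeneous_0_is_const by blast
  have "\<exists>w'. D w g = D w' f" for w
    unfolding D_def using linear_combinations_of_gradients[OF inj h[unfolded G_def c]] .
  then show ?thesis using ed by blast
qed

text \<open>If \<open>\<nabla>g = B \<nabla>f\<close>, then \<open>B\<close> intertwines the Hessian of \<open>f\<close>. At a node the kernel of the
  Hessian is spanned by the point \<open>p\<close>, which is therefore an eigenvector of the transpose of \<open>B\<close>;
  after subtracting a multiple of \<open>f\<close> from \<open>g\<close>, the curve \<open>g = 0\<close> is a cone with vertex \<open>p\<close>.\<close>

lemma gradient_determines_form_with_node:
  assumes f: "homogeneous d f" "d \<ge> 4" and n: "node_at f p"
    and g: "homogeneous d g" and C: "\<And>w. \<exists>w'. D w g = D w' f"
  shows "\<exists>c. g = const c * f"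
proof -
  obtain u v where uv: "dotp p (cr u v) \<noteq> 0"
    and H: "ev (D u (D u f)) p * ev (D v (D v f)) p - ev (D u (D v f)) p ^ 2 \<noteq> 0"
    and z: "ev f p = 0" "ev (D u f) p = 0" "ev (D v f) p = 0"
    using node_hessian[OF n] by metis
  have basis: "\<exists>\<alpha> \<beta> \<gamma>. w = \<alpha> *s p + \<beta> *s u + \<gamma> *s v" for w
  proof -
    let ?\<Delta> = "dotp p (cr u v)"
    have "?\<Delta> *s w = dotp w (cr u v) *s p + dotp w (cr v p) *s u + dotp w (cr p u) *s v"
      by (simp add: vec3_eq_iff dotp_def algebra_simps)
    then have "inverse ?\<Delta> *s (?\<Delta> *s w) = inverse ?\<Delta> *s (dotp w (cr u v) *s p + dotp w (cr v p) *s u + dotp w (cr p u) *s v)"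
      by simp
    then have "w = (inverse ?\<Delta> * dotp w (cr u v)) *s p + (inverse ?\<Delta> * dotp w (cr v p)) *s u
        + (inverse ?\<Delta> * dotp w (cr p u)) *s v"
      using uv by (simp add: vector_add_ldistrib)
    then show ?thesis by blast
  qed
  have "ev (D p f) p = 0" using ev_D_self[OF f(1), of p] z(1) by simp
  then have Df: "ev (D w f) p = 0" for w
    using basis[of w] z by (auto simp: D_linear)
  have Dp: "ev (D w (D p f)) p = 0" for w
    unfolding D_commute[of w p] ev_D_self[OF homogeneous_D[OF f(1)]] by (simp add: Df)
  have nondeg: "\<exists>\<beta>. y = \<beta> *s p" if y: "\<And>w. ev (D w (D y f)) p = 0" for y
  proof -
    obtain \<alpha> \<beta> \<gamma> where e: "y = \<alpha> *s p + \<beta> *s u + \<gamma> *s v" using basis by blast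
    define a where "a = ev (D u (D u f)) p"
    define b where "b = ev (D u (D v f)) p"
    define c where "c = ev (D v (D v f)) p"
    have b': "ev (D v (D u f)) p = b" unfolding b_def by (simp only: D_commute)
    have De: "D w (D y f) = const \<alpha> * D w (D p f) + const \<beta> * D w (D u f) + const \<gamma> * D w (D v f)" for w
      unfolding e D_linear by (simp add: D_simps)
    have 1: "\<beta> * a + \<gamma> * b = 0" using y[of u] Dp[of u] unfolding De by (simp add: a_def b_def)
    have 2: "\<beta> * b + \<gamma> * c = 0" using y[of v] Dp[of v] unfolding De by (simp add: b' c_def)
    have H': "a * c - b ^ 2 \<noteq> 0" using H by (simp add: a_def b_def c_def)
    have "\<beta> * (a * c - b ^ 2) = c * (\<beta> * a + \<gamma> * b) - b * (\<beta> * b + \<gamma> * c)"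
      by (simp add: algebra_simps power2_eq_square)
    then have "\<beta> = 0" using 1 2 H' by simp
    moreover have "\<gamma> * (a * c - b ^ 2) = a * (\<beta> * b + \<gamma> * c) - b * (\<beta> * a + \<gamma> * b)"
      by (simp add: algebra_simps power2_eq_square)
    then have "\<gamma> = 0" using 1 2 H' by simp
    ultimately show ?thesis using e by auto
  qed
  obtain C where C: "\<And>w. D w g = D (C w) f" using C by metis
  have "ev (D w (D (C p) f)) p = 0" for w
  proof -
    have "D w (D (C p) f) = D p (D (C w) f)" by (metis C D_commute)
    then show ?thesis by (simp add: ev_D_self[OF homogeneous_D[OF f(1)]] Df)
  qed
  then obtain \<mu> where \<mu>: "C p = \<mu> *s p" using nondeg by blast
  define h where "h = g - const \<mu> * f"
  define y where "y w = C w - \<mu> *s w" for w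
  have h: "D w h = D (y w) f" for w
    unfolding h_def y_def by (simp add: D_simps D_linear C)
  have "D p h = 0" unfolding h y_def by (simp add: \<mu> D_def constv_simps dotp_simps)
  then have py: "D p (D (y w) f) = 0" for w
    unfolding h[symmetric] D_commute[of p w] by (simp add: D_simps)
  have "y w = 0" for w
  proof -
    have "ev (D w' (D (y w) f)) p = 0" for w'
    proof -
      have "D p (D w' (D (y w) f)) = 0" unfolding D_commute[of p w'] by (simp add: py D_simps)
      moreover have "homogeneous (d - 1 - 1) (D w' (D (y w) f))" by (intro homogeneous_D f)
      ultimately have "of_nat (d - 1 - 1) * ev (D w' (D (y w) f)) p = 0" using ev_D_self by (metis ev_simps(3))
      moreover have "d - 1 - 1 \<noteq> 0" using f(2) by simp
      ultimately show ?thesis by (metis mult_eq_0_iff of_nat_eq_0_iff)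
    qed
    then obtain \<beta> where \<beta>: "y w = \<beta> *s p" using nondeg by blast
    have "\<beta> = 0"
    proof (rule ccontr)
      assume "\<beta> \<noteq> 0"
      have "const \<beta> * D p (D p f) = 0" using py[of w] unfolding \<beta> D_linear by (simp add: D_simps)
      then have pp: "D p (D p f) = 0" using \<open>\<beta> \<noteq> 0\<close> by simp
      have "ev (D a (D b f)) p = 0" for a b
      proof -
        let ?F = "D a (D b f)"
        have "D p (D p ?F) = D a (D b (D p (D p f)))" by (metis D_commute)
        then have "D p (D p ?F) = 0" by (simp add: pp D_simps)
        moreover have hF: "homogeneous (d - 1 - 1) ?F" by (intro homogeneous_D f)
        ultimately have "of_nat (d - 1 - 1 - 1) * (of_nat (d - 1 - 1) * ev ?F p) = 0"
          using ev_D_self[OF homogeneous_D[OF hF], of p p] ev_D_self[OF hF, of p] by simp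
        moreover have "d - 1 - 1 \<noteq> 0" "d - 1 - 1 - 1 \<noteq> 0" using f(2) by auto
        ultimately show ?thesis by (metis mult_eq_0_iff of_nat_eq_0_iff)
      qed
      then show False using H by simp
    qed
    then show ?thesis using \<beta> by simp
  qed
  then have "D w h = 0" for w unfolding h by (simp add: D_def constv_simps dotp_simps)
  then have D0: "dotp (constv w) (grad h) = 0" for w by (simp add: D_def)
  have "constv (axis i 1) = axis i 1" for i by (simp add: vec_eq_iff axis_def)
  then have "grad h $ i = 0" for i using D0[of "axis i 1"] by (simp add: dotp_axis)
  then have "grad h = 0" by (simp add: vec_eq_iff)
  moreover have "homogeneous d h"
    unfolding h_def by (intro homogeneous_diff homogeneous_const_mult f g)
  ultimately have "h = 0" using grad_0_imp_0 f(2) by (metis le_trans one_le_numeral)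
  then show ?thesis unfolding h_def by (intro exI[of _ \<mu>]) simp
qed

theorem theorem5p7:
  fixes f :: tpoly and d n :: nat
  assumes "reduced_curve d f"
    and "nodal f"
    and "d \<ge> 4"
    and "card (nodes f) = n"
    and "n > 0"
    and "(irreducible f \<and> real n < (real d - 1) / 2) \<or>
         (\<not> irreducible f \<and> real n < (real d - 2) / 2)"
  shows "torelli f"
  unfolding torelli_def
proof (intro allI impI)
  fix e g assume g: "reduced_curve e g \<and> sheaf_iso (log_sheaf g) (log_sheaf f)"
  have "real (2 * n + 1) < real d" using assms(6) by auto
  then have "2 * n + 1 < d" by linarith
  then have n: "card (nodes f) + 3 \<le> d" using assms(3,4) by simp
  have fin: "finite (nodes f)" using assms(4,5) card_ge_0_finite by blast
  have "nodes f \<noteq> {}" using assms(4,5) by auto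
  then obtain p where p: "node_at f p" by (auto simp: nodes_def)
  have "e = d \<and> (\<forall>w. \<exists>w'. D w g = D w' f)"
    using nodal_gradient_determined[OF assms(1,2) _ fin n] assms(3) g by auto
  moreover have "homogeneous d f" "homogeneous e g" "squarefree g"
    using assms(1) g by (auto simp: reduced_curve_def)
  ultimately obtain c where c: "g = const c * f"
    using gradient_determines_form_with_node[OF _ assms(3) p] by metis
  have "c \<noteq> 0" using c \<open>squarefree g\<close> by auto
  moreover have "g = smult [:[:c:]:] f" using c by (simp add: const_def)
  ultimately show "same_curve f g" unfolding same_curve_def by blast
qed

end
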